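(* Let $\mathcal D$ be a fundamental sub-semigroup of $\mathcal C(X)$, where $X$ is an infinite-dimensional real Banach space, and let $\mu$ be a convex measure of non-property $\mathfrak D$ (with respect to $\mathcal D$) on $X$. Let $I=[0,a]$ with $a>0$, let $G\subseteq L_1(I,X)$ be a nonempty bounded subset, and let $\psi\in L_1(I,\mathbb R^+)$ be such that $\sup_{g\in G}\|g(t)\|\le\psi(t)$ for a.e. $t\in I$. Assume that $\mathbb J_G:I\to C_b(\Omega)$ is strongly measurable. Then $t\mapsto\mu\big(G(t)\big)$ is measurable and $$\mu\Big(\int_0^tG(s)\,ds\Big)\le\frac1t\int_0^t\mu\big(tG(s)\big)\,ds,\qquad\forall\,0<t\le a.$$
   Context: $\mathcal B(X)$ is the set of nonempty bounded subsets of $X$; $\mathcal C(X)$ is the set of nonempty closed bounded convex subsets of $X$ with addition $A\oplus B=\overline{A+B}$, scalar multiplication of sets, and the Hausdorff metric. A fundamental sub-semigroup of $\mathcal C(X)$ is a subset $\mathcal D\subset\mathcal C(X)$, closed in the Hausdorff metric and closed under $\oplus$ and scalar multiplication, such that: $\bigcup\{D\in\mathcal D\}=X$; $A,B\in\mathcal D$ entails $\overline{\rm co}(\pm A\cup\pm B)\in\mathcal D$, where $\pm A\cup\pm B=A\cup(-A)\cup B\cup(-B)$; and $\emptyset\ne B\subset D\in\mathcal D$ implies $\overline{\rm co}(B)\in\mathcal D$. A convex measure of non-property $\mathfrak D$ (with respect to $\mathcal D$) on $X$ is a function $\mu:\mathcal B(X)\to[0,\infty)$ such that for all $A,B\in\mathcal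 B(X)$: (1) $\mu(B)=0$ iff $\overline{\rm co}(B)\in\mathcal D$; (2) $A\supset B$ implies $\mu(A)\ge\mu(B)$; (3) $\mu({\rm co}(B))=\mu(B)$; (4) $\mu(\lambda A+(1-\lambda)B)\le\lambda\mu(A)+(1-\lambda)\mu(B)$ for $0\le\lambda\le1$. $L_1(I,X)$ is the space of Lebesgue–Bochner integrable $X$-valued functions on $I$; $G(t)=\{g(t):g\in G\}$, $tG(s)=\{t\,g(s):g\in G\}$ and $\int_0^tG(s)ds=\{\int_0^tg(s)ds:g\in G\}$. The integral on the right may be $+\infty$. $\Omega=B_{X^*}$ with the norm topology, $C_b(\Omega)$ is the Banach space of bounded continuous real functions on $\Omega$ with the sup-norm, and $\mathbb J_G$ is defined (for a.e. $t$) by $\mathbb J_G(t)(x^* )=\sup_{g\in G}\langle x^*,g(t)\rangle$, $x^*\in\Omega$. Strongly measurable means being the a.e. norm-limit of a sequence of simple functions. *)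

theory Defs
  imports "HOL-Analysis.Analysis"
begin

section \<open>Closed bounded convex sets and the Hausdorff metric\<close>

definition bounded_sets :: "'a::real_normed_vector set set"
  where "bounded_sets = {B. B \<noteq> {} \<and> bounded B}"

definition closed_bounded_convex_sets :: "'a::real_normed_vector set set"
  where "closed_bounded_convex_sets = {A. A \<noteq> {} \<and> closed A \<and> bounded A \<and> convex A}"

text \<open>The value 0 off the nonempty bounded sets is a junk value; it makes the function
  nonnegative everywhere, as \<^locale>\<open>Metric_space\<close> requires.\<close>

definition hausdorff_dist :: "'a::metric_space set \<Rightarrow> 'a set \<Rightarrow> real"
  where "hausdorff_dist A B =
    (if A = {} \<or> B = {} \<or> \<not> bounded A \<or> \<not> bounded B then 0
     else max (SUP a\<in>A. infdist a B) (SUP b\<in>B. infdist b A))"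

lemma bdd_above_infdist:
  assumes "bounded A" "B \<noteq> {}"
  shows "bdd_above ((\<lambda>a. infdist a B) ` A)"
proof -
  obtain b where b: "b \<in> B" using assms(2) by blast
  obtain K where "\<forall>a\<in>A. dist b a \<le> K"
    using assms(1) bounded_any_center by blast
  then have "infdist a B \<le> K" if "a \<in> A" for a
    using that infdist_le[OF b, of a] by (force simp: dist_commute)
  then show ?thesis by (intro bdd_aboveI2)
qed

lemma hausdorff_dist_upper:
  assumes "A \<noteq> {}" "B \<noteq> {}" "bounded A" "bounded B" "a \<in> A"
  shows "infdist a B \<le> hausdorff_dist A B"
  using cSUP_upper[OF assms(5) bdd_above_infdist[OF assms(3,2)]] assms
  by (simp add: hausdorff_dist_def)

lemma hausdorff_dist_commute: "hausdorff_dist A B = hausdorff_dist B A"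
  by (auto simp: hausdorff_dist_def max.commute)

lemma hausdorff_dist_nonneg: "0 \<le> hausdorff_dist A B"
proof (cases "A = {} \<or> B = {} \<or> \<not> bounded A \<or> \<not> bounded B")
  case True
  then show ?thesis by (auto simp: hausdorff_dist_def)
next
  case False
  then obtain a where "a \<in> A" by blast
  with False show ?thesis
    using hausdorff_dist_upper[of A B a] infdist_nonneg[of a B] by simp
qed

lemma hausdorff_dist_triangle_aux:
  assumes "A \<noteq> {}" "B \<noteq> {}" "C \<noteq> {}" "bounded A" "bounded B" "bounded C"
    and a: "a \<in> A"
  shows "infdist a C \<le> hausdorff_dist A B + hausdorff_dist B C"
proof -
  have "infdist a C - hausdorff_dist B C \<le> dist a b" if "b \<in> B" for b
    using infdist_triangle[of a C b] hausdorff_dist_upper[of B C b] assms that by simp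
  then have "infdist a C - hausdorff_dist B C \<le> infdist a B"
    using assms(2) by (auto simp: infdist_notempty intro: cINF_greatest)
  then show ?thesis
    using hausdorff_dist_upper[of A B a] assms by simp
qed

lemma Metric_space_hausdorff:
  "Metric_space (closed_bounded_convex_sets :: 'a::real_normed_vector set set) hausdorff_dist"
proof
  fix A B C :: "'a set"
  show "0 \<le> hausdorff_dist A B" by (rule hausdorff_dist_nonneg)
  show "hausdorff_dist A B = hausdorff_dist B A" by (rule hausdorff_dist_commute)
  assume AB: "A \<in> closed_bounded_convex_sets" "B \<in> closed_bounded_convex_sets"
  have sub: "P \<subseteq> Q" if "hausdorff_dist P Q = 0"
    "P \<in> closed_bounded_convex_sets" "Q \<in> closed_bounded_convex_sets" for P Q :: "'a set"
  proof
    fix p assume "p \<in> P"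
    then have "infdist p Q \<le> 0"
      using hausdorff_dist_upper[of P Q p] that by (auto simp: closed_bounded_convex_sets_def)
    then show "p \<in> Q"
      using that(3) infdist_nonneg[of p Q]
      by (auto simp: closed_bounded_convex_sets_def in_closed_iff_infdist_zero)
  qed
  show "hausdorff_dist A B = 0 \<longleftrightarrow> A = B"
  proof
    assume "hausdorff_dist A B = 0"
    then show "A = B"
      using sub[of A B] sub[of B A] AB by (auto simp: hausdorff_dist_commute)
  next
    assume "A = B"
    then show "hausdorff_dist A B = 0"
      by (auto simp: hausdorff_dist_def)
  qed
  assume C: "C \<in> closed_bounded_convex_sets"
  have "(SUP a\<in>A. infdist a C) \<le> hausdorff_dist A B + hausdorff_dist B C"
    using AB C by (intro cSUP_least hausdorff_dist_triangle_aux)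
      (auto simp: closed_bounded_convex_sets_def)
  moreover have "(SUP c\<in>C. infdist c A) \<le> hausdorff_dist C B + hausdorff_dist B A"
    using AB C by (intro cSUP_least hausdorff_dist_triangle_aux)
      (auto simp: closed_bounded_convex_sets_def)
  ultimately show "hausdorff_dist A C \<le> hausdorff_dist A B + hausdorff_dist B C"
    using AB C hausdorff_dist_commute[of B C] hausdorff_dist_commute[of A B]
    by (simp add: closed_bounded_convex_sets_def hausdorff_dist_def[of A C])
qed


section \<open>Fundamental sub-semigroups and convex measures of non-property\<close>

text \<open>On sets, \<open>A + B\<close> is the Minkowski sum, whereas unary minus would be the complement;
  the reflected set is therefore written as an image.\<close>

locale fundamental_subsemigroup =
  fixes \<D> :: "'a::real_normed_vector set set"
  assumes subset: "\<D> \<subseteq> closed_bounded_convex_sets"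
    and closed: "closedin (Metric_space.mtopology closed_bounded_convex_sets hausdorff_dist) \<D>"
    and oplus: "\<And>A B. A \<in> \<D> \<Longrightarrow> B \<in> \<D> \<Longrightarrow> closure (A + B) \<in> \<D>"
    and scale: "\<And>(c::real) A. A \<in> \<D> \<Longrightarrow> (\<lambda>x. c *\<^sub>R x) ` A \<in> \<D>"
    and covers: "\<Union>\<D> = UNIV"
    and symm_hull: "\<And>A B. A \<in> \<D> \<Longrightarrow> B \<in> \<D> \<Longrightarrow>
      closure (convex hull (A \<union> uminus ` A \<union> B \<union> uminus ` B)) \<in> \<D>"
    and hereditary: "\<And>B D. B \<noteq> {} \<Longrightarrow> B \<subseteq> D \<Longrightarrow> D \<in> \<D> \<Longrightarrow> closure (convex hull B) \<in> \<D>"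

text \<open>Only the values of \<open>\<mu>\<close> on \<^const>\<open>bounded_sets\<close> are constrained.\<close>

locale convex_measure_of_nonproperty =
  fixes \<D> :: "'a::real_normed_vector set set" and \<mu> :: "'a set \<Rightarrow> real"
  assumes nonneg: "\<And>B. B \<in> bounded_sets \<Longrightarrow> 0 \<le> \<mu> B"
    and zero_iff: "\<And>B. B \<in> bounded_sets \<Longrightarrow> \<mu> B = 0 \<longleftrightarrow> closure (convex hull B) \<in> \<D>"
    and mono: "\<And>A B. A \<in> bounded_sets \<Longrightarrow> B \<in> bounded_sets \<Longrightarrow> B \<subseteq> A \<Longrightarrow> \<mu> B \<le> \<mu> A"
    and convex_hull: "\<And>B. B \<in> bounded_sets \<Longrightarrow> \<mu> (convex hull B) = \<mu> B"
    and convexity: "\<And>A B (u::real). A \<in> bounded_sets \<Longrightarrow> B \<in> bounded_sets \<Longrightarrow> 0 \<le> u \<Longrightarrow> u \<le> 1 \<Longrightarrow>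
      \<mu> ((\<lambda>x. u *\<^sub>R x) ` A + (\<lambda>x. (1 - u) *\<^sub>R x) ` B) \<le> u * \<mu> A + (1 - u) * \<mu> B"


section \<open>Strong measurability and the Bochner integral in arbitrary Banach spaces\<close>

text \<open>The library's \<^const>\<open>integrable\<close> and \<^const>\<open>lebesgue_integral\<close> are restricted to
  second-countable (i.e. separable) spaces. The definitions below follow the library's
  \<^const>\<open>has_bochner_integral\<close>, with Borel measurability replaced by strong measurability.\<close>

definition strongly_measurable :: "'a measure \<Rightarrow> ('a \<Rightarrow> 'b::real_normed_vector) \<Rightarrow> bool"
  where "strongly_measurable M f \<longleftrightarrow>
    (\<exists>s. (\<forall>n. simple_function M (s n)) \<and> (AE x in M. (\<lambda>n. s n x) \<longlonglongrightarrow> f x))"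

definition has_Bochner_integral :: "'a measure \<Rightarrow> ('a \<Rightarrow> 'b::real_normed_vector) \<Rightarrow> 'b \<Rightarrow> bool"
  where "has_Bochner_integral M f y \<longleftrightarrow> strongly_measurable M f \<and>
    (\<exists>s. (\<forall>n. Bochner_Integration.simple_bochner_integrable M (s n)) \<and>
         (\<lambda>n. \<integral>\<^sup>+x. ennreal (norm (f x - s n x)) \<partial>M) \<longlonglongrightarrow> 0 \<and>
         (\<lambda>n. Bochner_Integration.simple_bochner_integral M (s n)) \<longlonglongrightarrow> y)"

definition Bochner_integrable :: "'a measure \<Rightarrow> ('a \<Rightarrow> 'b::real_normed_vector) \<Rightarrow> bool"
  where "Bochner_integrable M f \<longleftrightarrow> (\<exists>y. has_Bochner_integral M f y)"

definition Bochner_integral :: "'a measure \<Rightarrow> ('a \<Rightarrow> 'b::real_normed_vector) \<Rightarrow> 'b"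
  where "Bochner_integral M f = (THE y. has_Bochner_integral M f y)"

lemma strongly_measurable_norm_diff_AE:
  fixes f :: "'a \<Rightarrow> 'b::real_normed_vector"
  assumes "strongly_measurable M f" "simple_function M r"
  obtains h :: "'a \<Rightarrow> real" where "h \<in> borel_measurable M" "AE x in M. norm (f x - r x) = h x"
proof -
  obtain s where s: "\<And>n. simple_function M (s n)" "AE x in M. (\<lambda>n. s n x) \<longlonglongrightarrow> f x"
    using assms(1) by (auto simp: strongly_measurable_def)
  define h where "h x = lim (\<lambda>n. norm (s n x - r x))" for x
  have "simple_function M (\<lambda>x. norm (s n x - r x))" for n
    using simple_function_compose2[OF s(1) assms(2), of "\<lambda>u v. norm (u - v)"] .
  then have "h \<in> borel_measurable M"
    unfolding h_def by (intro borel_measurable_lim_metric borel_measurable_simple_function)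
  moreover have "AE x in M. norm (f x - r x) = h x"
    using s(2)
  proof eventually_elim
    case (elim x)
    then have "(\<lambda>n. norm (s n x - r x)) \<longlonglongrightarrow> norm (f x - r x)"
      by (intro tendsto_intros)
    then show ?case by (simp add: h_def limI)
  qed
  ultimately show ?thesis using that by blast
qed

lemma has_Bochner_integral_unique:
  fixes f :: "'a \<Rightarrow> 'b::real_normed_vector"
  assumes "has_Bochner_integral M f y" "has_Bochner_integral M f z"
  shows "y = z"
proof -
  have sm: "strongly_measurable M f" using assms by (auto simp: has_Bochner_integral_def)
  obtain s where s: "\<And>n. Bochner_Integration.simple_bochner_integrable M (s n)"
      "(\<lambda>n. \<integral>\<^sup>+x. ennreal (norm (f x - s n x)) \<partial>M) \<longlonglongrightarrow> 0"
      "(\<lambda>n. Bochner_Integration.simple_bochner_integral M (s n)) \<longlonglongrightarrow> y"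
    using assms(1) by (auto simp: has_Bochner_integral_def)
  obtain t where t: "\<And>n. Bochner_Integration.simple_bochner_integrable M (t n)"
      "(\<lambda>n. \<integral>\<^sup>+x. ennreal (norm (f x - t n x)) \<partial>M) \<longlonglongrightarrow> 0"
      "(\<lambda>n. Bochner_Integration.simple_bochner_integral M (t n)) \<longlonglongrightarrow> z"
    using assms(2) by (auto simp: has_Bochner_integral_def)
  let ?S = "\<lambda>n. \<integral>\<^sup>+x. ennreal (norm (f x - s n x)) \<partial>M"
  let ?T = "\<lambda>n. \<integral>\<^sup>+x. ennreal (norm (f x - t n x)) \<partial>M"
  have bound: "ennreal (norm (Bochner_Integration.simple_bochner_integral M (s n) - Bochner_Integration.simple_bochner_integral M (t n)))
      \<le> ?S n + ?T n" for n
  proof -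
    have sf: "simple_function M (s n)" "simple_function M (t n)"
      using s(1) t(1) by (auto elim: simple_bochner_integrable.cases)
    obtain h where h: "h \<in> borel_measurable M" "AE x in M. norm (f x - s n x) = h x"
      using strongly_measurable_norm_diff_AE[OF sm sf(1)] by blast
    obtain k where k: "k \<in> borel_measurable M" "AE x in M. norm (f x - t n x) = k x"
      using strongly_measurable_norm_diff_AE[OF sm sf(2)] by blast
    have st: "Bochner_Integration.simple_bochner_integrable M (\<lambda>x. norm (s n x - t n x))"
      using simple_bochner_integrable_compose2[of "\<lambda>u v. norm (u - v)" M "s n" "t n"] s(1) t(1)
      by simp
    have "norm (Bochner_Integration.simple_bochner_integral M (s n) - Bochner_Integration.simple_bochner_integral M (t n))
        \<le> Bochner_Integration.simple_bochner_integral M (\<lambda>x. norm (s n x - t n x))"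
      using simple_bochner_integral_norm_bound[of M "\<lambda>x. s n x - t n x"]
        simple_bochner_integrable_compose2[of "(-)" M "s n" "t n"] s(1) t(1)
      by (simp add: simple_bochner_integral_diff)
    then have "ennreal (norm (Bochner_Integration.simple_bochner_integral M (s n) - Bochner_Integration.simple_bochner_integral M (t n)))
        \<le> (\<integral>\<^sup>+x. ennreal (norm (s n x - t n x)) \<partial>M)"
      by (subst simple_bochner_integral_eq_nn_integral[OF st, symmetric]) (auto intro: ennreal_leI)
    also have "\<dots> \<le> (\<integral>\<^sup>+x. ennreal (h x) + ennreal (k x) \<partial>M)"
    proof (rule nn_integral_mono_AE)
      show "AE x in M. ennreal (norm (s n x - t n x)) \<le> ennreal (h x) + ennreal (k x)"
        using h(2) k(2)
      proof eventually_elim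
        case (elim x)
        have "norm (s n x - t n x) \<le> norm (f x - s n x) + norm (f x - t n x)"
          by (metis dual_order.refl norm_diff_triangle_le norm_minus_commute)
        then show ?case unfolding elim(1)[symmetric] elim(2)[symmetric]
          by (simp flip: ennreal_plus)
      qed
    qed
    also have "\<dots> = (\<integral>\<^sup>+x. ennreal (h x) \<partial>M) + (\<integral>\<^sup>+x. ennreal (k x) \<partial>M)"
      using h(1) k(1) by (intro nn_integral_add) auto
    also have "(\<integral>\<^sup>+x. ennreal (h x) \<partial>M) = ?S n"
      using h(2) by (intro nn_integral_cong_AE) auto
    also have "(\<integral>\<^sup>+x. ennreal (k x) \<partial>M) = ?T n"
      using k(2) by (intro nn_integral_cong_AE) auto
    finally show ?thesis .
  qed
  have "(\<lambda>n. ?S n + ?T n) \<longlonglongrightarrow> 0 + 0"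
    by (intro tendsto_add s(2) t(2))
  then have "(\<lambda>n. ?S n + ?T n) \<longlonglongrightarrow> 0" by simp
  from tendsto_sandwich[OF always_eventually always_eventually tendsto_const this]
  have "(\<lambda>n. ennreal (norm (Bochner_Integration.simple_bochner_integral M (s n) -
      Bochner_Integration.simple_bochner_integral M (t n)))) \<longlonglongrightarrow> ennreal 0"
    using bound by simp
  then have "(\<lambda>n. norm (Bochner_Integration.simple_bochner_integral M (s n) - Bochner_Integration.simple_bochner_integral M (t n))) \<longlonglongrightarrow> 0"
    by (subst (asm) tendsto_ennreal_iff) auto
  moreover have "(\<lambda>n. norm (Bochner_Integration.simple_bochner_integral M (s n) - Bochner_Integration.simple_bochner_integral M (t n)))
      \<longlonglongrightarrow> norm (y - z)"
    by (intro tendsto_intros s(3) t(3))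
  ultimately show ?thesis
    using LIMSEQ_unique by fastforce
qed

lemma Bochner_integral_eqI: "has_Bochner_integral M f y \<Longrightarrow> Bochner_integral M f = y"
  unfolding Bochner_integral_def using has_Bochner_integral_unique by blast


section \<open>Support functions on the dual unit ball\<close>

typedef (overloaded) 'a dual_ball = "{f :: 'a::real_normed_vector \<Rightarrow>\<^sub>L real. norm f \<le> 1}"
  morphisms dual_ball_functional Abs_dual_ball
  by (auto intro: exI[of _ 0])

instantiation dual_ball :: (real_normed_vector) metric_space
begin

definition dist_dual_ball :: "'a dual_ball \<Rightarrow> 'a dual_ball \<Rightarrow> real"
  where "dist_dual_ball x y = norm (dual_ball_functional x - dual_ball_functional y)"

definition uniformity_dual_ball :: "('a dual_ball \<times> 'a dual_ball) filter"
  where "uniformity_dual_ball = (INF e\<in>{0 <..}. principal {(x, y). dist x y < e})"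

definition open_dual_ball :: "'a dual_ball set \<Rightarrow> bool"
  where "open_dual_ball U \<longleftrightarrow> (\<forall>x\<in>U. \<forall>\<^sub>F (x', y) in uniformity. x' = x \<longrightarrow> y \<in> U)"

instance
proof
  fix x y z :: "'a dual_ball"
  show "dist x y = 0 \<longleftrightarrow> x = y"
    by (simp add: dist_dual_ball_def dual_ball_functional_inject)
  show "dist x y \<le> dist x z + dist y z"
    unfolding dist_dual_ball_def
    by (metis dist_norm dist_triangle2)
qed (simp_all add: uniformity_dual_ball_def open_dual_ball_def)

end

text \<open>\<open>support_fun G t\<close> is meaningful when \<open>{g t | g. g \<in> G}\<close> is nonempty and bounded, which in
  the theorem holds for almost every \<open>t\<close>.\<close>

definition support_fun :: "(real \<Rightarrow> 'a::real_normed_vector) set \<Rightarrow> real \<Rightarrow> ('a dual_ball \<Rightarrow>\<^sub>C real)"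
  where "support_fun G t = Bcontfun (\<lambda>x. SUP g\<in>G. blinfun_apply (dual_ball_functional x) (g t))"

lemma apply_support_fun:
  fixes G :: "(real \<Rightarrow> 'a::real_normed_vector) set"
  assumes "G \<noteq> {}" "bounded {g t | g. g \<in> G}"
  shows "apply_bcontfun (support_fun G t) x =
    (SUP g\<in>G. blinfun_apply (dual_ball_functional x) (g t))"
proof -
  let ?p = "\<lambda>x. SUP g\<in>G. blinfun_apply (dual_ball_functional x) (g t)"
  obtain K where K: "\<And>g. g \<in> G \<Longrightarrow> norm (g t) \<le> K"
    using assms(2) by (auto simp: bounded_iff)
  have K0: "0 \<le> K" using assms(1) K norm_ge_zero order_trans by blast
  have n1: "norm (dual_ball_functional x) \<le> 1" for x :: "'a dual_ball"
    using dual_ball_functional by auto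
  have ap: "\<bar>blinfun_apply (dual_ball_functional x) (g t)\<bar> \<le> K" if "g \<in> G" for g and x :: "'a dual_ball"
  proof -
    have "\<bar>blinfun_apply (dual_ball_functional x) (g t)\<bar> \<le> norm (dual_ball_functional x) * norm (g t)"
      using norm_blinfun[of "dual_ball_functional x" "g t"] by simp
    also have "\<dots> \<le> 1 * K" by (intro mult_mono n1 K that) auto
    finally show ?thesis by simp
  qed
  have bdd: "bdd_above ((\<lambda>g. blinfun_apply (dual_ball_functional x) (g t)) ` G)" for x :: "'a dual_ball"
    using ap by (intro bdd_aboveI2[where M=K]) (auto simp: abs_le_iff)
  have lip: "?p x \<le> ?p y + K * dist x y" for x y :: "'a dual_ball"
  proof (rule cSUP_least[OF assms(1)])
    fix g assume g: "g \<in> G"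
    have "blinfun_apply (dual_ball_functional x) (g t) - blinfun_apply (dual_ball_functional y) (g t)
        \<le> norm (dual_ball_functional x - dual_ball_functional y) * norm (g t)"
      using norm_blinfun[of "dual_ball_functional x - dual_ball_functional y" "g t"]
      by (simp add: blinfun.diff_left)
    also have "\<dots> \<le> dist x y * K"
      unfolding dist_dual_ball_def by (intro mult_left_mono K g) auto
    finally show "blinfun_apply (dual_ball_functional x) (g t) \<le> ?p y + K * dist x y"
      using cSUP_upper[OF g bdd[of y]] by (simp add: mult.commute)
  qed
  have "K-lipschitz_on UNIV ?p"
  proof (rule lipschitz_onI[OF _ K0])
    fix x y :: "'a dual_ball"
    show "dist (?p x) (?p y) \<le> K * dist x y"
      using lip[of x y] lip[of y x] by (simp add: dist_real_def dist_commute abs_le_iff)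
  qed
  then have "continuous_on UNIV ?p" by (rule lipschitz_on_continuous_on)
  moreover have "\<bar>?p x\<bar> \<le> K" for x :: "'a dual_ball"
    using ap assms(1) by (intro cSup_abs_le) auto
  then have "bounded (range ?p)" by (auto simp: bounded_iff)
  ultimately have "?p \<in> bcontfun" by (simp add: bcontfun_def)
  then show ?thesis by (simp add: support_fun_def Bcontfun_inverse)
qed

end

theory Submission
  imports Defs
begin

text \<open>A convex measure of non-property \<open>\<mu>\<close> satisfies
  \<open>\<mu> A \<le> \<mu> B + C \<delta>\<close> whenever every functional in the dual unit ball is on \<open>A\<close> at most \<open>\<delta>\<close> larger
  than its supremum over \<open>B\<close>: by Hahn-Banach \<open>A\<close> then lies close to the convex hull of \<open>B\<close>, and
  \<open>b + \<delta> u = (1 - 2\<delta>) b + 2\<delta> (b + u / 2)\<close> is a convex combination. Hence \<open>\<mu>\<close> is continuous along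
  the support functions, which gives measurability. For the inequality, a simple function close to
  the support functions splits the interval into finitely many sets on which these hardly vary
  and a remainder on which the integral of \<open>\<psi>\<close> is small; testing with functionals, where only scalar
  integrals occur, shows that the set of integrals lies close to a finite Minkowski sum of sets
  \<open>t \<cdot> G(s)\<close> weighted by relative lengths, and Jensen's inequality for \<open>\<mu>\<close> applies.\<close>

section \<open>Hahn-Banach separation\<close>

text \<open>Homogeneity is asked for positive factors only; the factor 2 at the zero vector still
  forces \<open>p 0 = 0\<close>.\<close>

definition sublinear :: "('a::real_vector \<Rightarrow> real) \<Rightarrow> bool" where
  "sublinear p \<longleftrightarrow> (\<forall>x y. p (x + y) \<le> p x + p y) \<and> (\<forall>c x. 0 < c \<longrightarrow> p (c *\<^sub>R x) = c * p x)"

lemma sublinear_add: "sublinear p \<Longrightarrow> p (x + y) \<le> p x + p y"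
  and sublinear_scale: "sublinear p \<Longrightarrow> 0 < c \<Longrightarrow> p (c *\<^sub>R x) = c * p x"
  by (auto simp: sublinear_def)

lemma sublinear_zero: "sublinear p \<Longrightarrow> p 0 = 0"
  using sublinear_scale[of p 2 0] by simp

lemma sublinear_uminus: "sublinear p \<Longrightarrow> - p (- x) \<le> p x"
  using sublinear_add[of p x "-x"] sublinear_zero[of p] by simp

text \<open>The one-sided bound used for \<open>inverse c\<close> at the vector
  \<open>c *\<^sub>R x\<close> gives the reverse inequality. This suits functionals defined as
  infima, where only one direction is immediate.\<close>

lemma sublinearI:
  fixes p :: "'a::real_vector \<Rightarrow> real"
  assumes add: "\<And>x y. p (x + y) \<le> p x + p y"
    and scale: "\<And>c x. 0 < c \<Longrightarrow> p (c *\<^sub>R x) \<le> c * p x"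
  shows "sublinear p"
proof -
  have "p (c *\<^sub>R x) = c * p x" if "0 < c" for c x
  proof (rule antisym)
    have "p (inverse c *\<^sub>R (c *\<^sub>R x)) \<le> inverse c * p (c *\<^sub>R x)"
      using that by (intro scale) simp
    with that show "c * p x \<le> p (c *\<^sub>R x)" by (simp add: field_simps)
  qed (rule scale[OF that])
  with add show ?thesis by (simp add: sublinear_def)
qed

text \<open>A pointwise minimal sublinear functional \<open>q\<close> coincides with the sublinear functional
  \<open>x \<mapsto> inf\<^sub>s (q (x + s y) - s q(y))\<close> for every \<open>y\<close>, hence is additive.\<close>

lemma minimal_sublinear_linear:
  fixes q :: "'a::real_vector \<Rightarrow> real"
  assumes q: "sublinear q" and minimal: "\<And>r. sublinear r \<Longrightarrow> r \<le> q \<Longrightarrow> r = q"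
  shows "linear q"
proof -
  have superadd: "q x + q y \<le> q (x + y)" for x y
  proof -
    define \<Phi> where "\<Phi> x s = q (x + s *\<^sub>R y) - s * q y" for x and s :: real
    define r where "r x = (INF s\<in>{0..}. \<Phi> x s)" for x
    \<comment> \<open>Subadditivity on \<open>s y = (x + s y) + (- x)\<close> bounds all
      \<open>\<Phi> x s\<close> from below, so the infimum \<open>r x\<close> is a genuine
      one.\<close>
    have low: "- q (- x) \<le> \<Phi> x s" if "0 \<le> s" for x s
    proof -
      have "q (s *\<^sub>R y) = s * q y"
        using that sublinear_scale[OF q] sublinear_zero[OF q] by (cases "s = 0") auto
      then show ?thesis
        using sublinear_add[OF q, of "x + s *\<^sub>R y" "- x"] by (simp add: \<Phi>_def)
    qed
    have bdd: "bdd_below (\<Phi> x ` {0..})" for x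
      using low by (intro bdd_belowI2[where m="- q (- x)"]) auto
    have r_le: "r x \<le> \<Phi> x s" if "0 \<le> s" for x s
      unfolding r_def using that by (intro cINF_lower bdd) auto
    have r_ge: "m \<le> r x" if "\<And>s. 0 \<le> s \<Longrightarrow> m \<le> \<Phi> x s" for m x
      unfolding r_def using that by (intro cINF_greatest) auto
    have "sublinear r"
    proof (rule sublinearI)
      fix x z
      have "r (x + z) - \<Phi> z t \<le> \<Phi> x s" if "0 \<le> s" "0 \<le> t" for s t
        using r_le[of "s + t" "x + z"] that
          sublinear_add[OF q, of "x + s *\<^sub>R y" "z + t *\<^sub>R y"]
        by (simp add: \<Phi>_def algebra_simps)
      then have "r (x + z) - \<Phi> z t \<le> r x" if "0 \<le> t" for t
        using that by (intro r_ge) auto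
      then have "r (x + z) - r x \<le> r z"
        by (intro r_ge) (simp add: algebra_simps)
      then show "r (x + z) \<le> r x + r z" by simp
    next
      fix c :: real and x assume c: "0 < c"
      have "r (c *\<^sub>R x) / c \<le> \<Phi> x s" if "0 \<le> s" for s
      proof -
        have "\<Phi> (c *\<^sub>R x) (c * s) = c * \<Phi> x s"
          using sublinear_scale[OF q c, of "x + s *\<^sub>R y"]
          by (simp add: \<Phi>_def algebra_simps)
        then show ?thesis
          using r_le[of "c * s" "c *\<^sub>R x"] c that by (simp add: field_simps)
      qed
      then have "r (c *\<^sub>R x) / c \<le> r x" by (rule r_ge)
      then show "r (c *\<^sub>R x) \<le> c * r x" using c by (simp add: field_simps)
    qed
    moreover have "r \<le> q"
      using r_le[of 0] by (auto simp: le_fun_def \<Phi>_def)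
    ultimately have "r = q" by (rule minimal)
    \<comment> \<open>With \<open>r = q\<close>, the choice \<open>s = 1\<close> reads
      \<open>q x \<le> q (x + y) - q y\<close>.\<close>
    then show ?thesis
      using r_le[of 1 x] by (simp add: \<Phi>_def)
  qed
  have add: "q (x + y) = q x + q y" for x y
    using superadd sublinear_add[OF q] by (intro antisym)
  have neg: "q (- x) = - q x" for x
    using add[of x "- x"] sublinear_zero[OF q] by simp
  have "q (c *\<^sub>R x) = c * q x" for c x
    using sublinear_scale[OF q, of c x] sublinear_scale[OF q, of "- c" x] sublinear_zero[OF q]
      neg[of "c *\<^sub>R x"]
    by (cases c "0::real" rule: linorder_cases) auto
  with add show ?thesis by (intro linearI) auto
qed

text \<open>Zorn's lemma in the reversed order yields a minimal sublinear functional below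
  \<open>p\<close>, which is linear. A nonempty chain is bounded by its pointwise infimum, kept
  finite by \<open>- p (- x) \<le> q x\<close>.\<close>

theorem hahn_banach_sublinear:
  fixes p :: "'a::real_vector \<Rightarrow> real"
  assumes p: "sublinear p"
  obtains f where "linear f" "\<And>x. f x \<le> p x"
proof -
  let ?A = "{q. sublinear q \<and> q \<le> p}"
  have "\<exists>q\<in>?A. \<forall>r\<in>?A. q \<ge> r \<longrightarrow> r = q"
  proof (rule predicate_Zorn)
    show "partial_order_on ?A (relation_of (\<ge>) ?A)"
      by (rule partial_order_on_relation_ofI) auto
  next
    fix C assume C: "C \<in> Chains (relation_of (\<ge>) ?A)"
    show "\<exists>u\<in>?A. \<forall>q\<in>C. q \<ge> u"
    proof (cases "C = {}")
      case True
      with p show ?thesis by auto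
    next
      case False
      have CA: "sublinear q" "q \<le> p" if "q \<in> C" for q
        using C that by (auto simp: Chains_def relation_of_def)
      have chain: "q \<le> r \<or> r \<le> q" if "q \<in> C" "r \<in> C" for q r
        using C that by (auto simp: Chains_def relation_of_def)
      define u where "u x = (INF q\<in>C. q x)" for x
      have "- p (- x) \<le> q x" if "q \<in> C" for q x
        using sublinear_uminus[OF CA(1)[OF that], of x] CA(2)[OF that]
        by (auto simp: le_fun_def intro: order_trans[rotated])
      then have bdd: "bdd_below ((\<lambda>q. q x) ` C)" for x
        by (intro bdd_belowI2)
      have u_le: "u x \<le> q x" if "q \<in> C" for q x
        unfolding u_def using that by (intro cINF_lower bdd)
      have u_ge: "m \<le> u x" if "\<And>q. q \<in> C \<Longrightarrow> m \<le> q x" for m x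
        unfolding u_def using that False by (intro cINF_greatest)
      have "sublinear u"
      proof (rule sublinearI)
        fix x y
        \<comment> \<open>Two members of a chain are comparable; subadditivity of the smaller one,
          \<open>m\<close>, bounds the mixed sum of \<open>q\<close> and \<open>r\<close>.\<close>
        have "u (x + y) - r y \<le> q x" if qr: "q \<in> C" "r \<in> C" for q r
        proof -
          obtain m where "m \<in> C" "m \<le> q" "m \<le> r"
            using chain[OF qr] qr by blast
          then show ?thesis
            using u_le[of m "x + y"] sublinear_add[OF CA(1), of m x y]
            by (auto simp: le_fun_def) (smt (verit))
        qed
        then have "u (x + y) - r y \<le> u x" if "r \<in> C" for r
          using that by (intro u_ge)
        then have "u (x + y) - u x \<le> u y"
          by (intro u_ge) (simp add: algebra_simps)
        then show "u (x + y) \<le> u x + u y" by simp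
      next
        fix c :: real and x assume c: "0 < c"
        have "u (c *\<^sub>R x) / c \<le> u x"
          using u_le[of _ "c *\<^sub>R x"] sublinear_scale[OF CA(1) c, of _ x] c
          by (intro u_ge) (simp add: field_simps)
        then show "u (c *\<^sub>R x) \<le> c * u x" using c by (simp add: field_simps)
      qed
      moreover have "u \<le> p"
        using False u_le CA(2) by (fastforce simp: le_fun_def intro: order_trans)
      ultimately show ?thesis
        using u_le by (intro bexI[of _ u]) (auto simp: le_fun_def)
    qed
  qed
  then obtain q where q: "sublinear q" "q \<le> p"
    and min: "\<And>r. sublinear r \<Longrightarrow> r \<le> p \<Longrightarrow> r \<le> q \<Longrightarrow> r = q"
    by blast
  have "linear q"
    using q by (intro minimal_sublinear_linear min) (auto intro: order_trans)
  with q(2) that show ?thesis by (auto simp: le_fun_def)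
qed

section \<open>Separation by functionals in the dual unit ball\<close>

abbreviation dual_apply :: "'a::real_normed_vector dual_ball \<Rightarrow> 'a \<Rightarrow> real"
  where "dual_apply w \<equiv> blinfun_apply (dual_ball_functional w)"

lemma dual_ball_le_norm: "\<bar>dual_apply w x\<bar> \<le> norm x"
proof -
  have "norm (dual_ball_functional w) \<le> 1" using dual_ball_functional by auto
  then show ?thesis
    using norm_blinfun[of "dual_ball_functional w" x]
      mult_right_mono[of "norm (dual_ball_functional w)" 1 "norm x"] by simp
qed

text \<open>Hahn-Banach is applied to \<open>p\<close>, the infimum of
  \<open>norm (x + s (b - a)) - s \<delta>\<close> over \<open>s \<ge> 0\<close> and
  \<open>a\<close> in \<open>A\<close>; convexity of \<open>A\<close> makes \<open>p\<close>
  subadditive. A linear \<open>f\<close> below \<open>p\<close> is below the norm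
  (\<open>s = 0\<close>), hence in the dual ball, and \<open>s = 1\<close> at
  \<open>x = a - b\<close> gives \<open>f (a - b) \<le> - \<delta>\<close>.\<close>

lemma dual_ball_separation:
  fixes A :: "'a::real_normed_vector set"
  assumes A: "convex A" "A \<noteq> {}" and far: "\<And>a. a \<in> A \<Longrightarrow> \<delta> \<le> norm (b - a)"
  obtains w where "\<And>a. a \<in> A \<Longrightarrow> dual_apply w a + \<delta> \<le> dual_apply w b"
proof -
  define \<Phi> where "\<Phi> x s a = norm (x + s *\<^sub>R (b - a)) - s * \<delta>" for x s a
  define p where "p x = (INF (s, a)\<in>{0..} \<times> A. \<Phi> x s a)" for x
  have low: "- norm x \<le> \<Phi> x s a" if "0 \<le> s" "a \<in> A" for x s a
  proof -
    have "s * \<delta> \<le> norm (s *\<^sub>R (b - a))"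
      using far[OF that(2)] that(1) by (simp add: mult_left_mono)
    also have "\<dots> \<le> norm (x + s *\<^sub>R (b - a)) + norm x"
      using norm_triangle_ineq4[of "x + s *\<^sub>R (b - a)" x] by simp
    finally show ?thesis by (simp add: \<Phi>_def)
  qed
  have bdd: "bdd_below ((\<lambda>(s, a). \<Phi> x s a) ` ({0..} \<times> A))" for x
    using low by (intro bdd_belowI2[where m="- norm x"]) auto
  have p_le: "p x \<le> \<Phi> x s a" if "0 \<le> s" "a \<in> A" for x s a
    using cINF_lower[OF bdd, of "(s, a)"] that by (simp add: p_def)
  have p_ge: "m \<le> p x" if "\<And>s a. 0 \<le> s \<Longrightarrow> a \<in> A \<Longrightarrow> m \<le> \<Phi> x s a" for m x
    unfolding p_def using that A(2) by (intro cINF_greatest) auto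
  have "sublinear p"
  proof (rule sublinearI)
    fix x y
    have "p (x + y) - \<Phi> y t a' \<le> \<Phi> x s a"
      if st: "0 \<le> s" "a \<in> A" "0 \<le> t" "a' \<in> A" for s a t a'
    proof -
      \<comment> \<open>The weighted mean of \<open>a\<close> and \<open>a'\<close>; if
        \<open>s + t = 0\<close> both weights vanish and any point of \<open>A\<close>
        serves.\<close>
      obtain c where c: "c \<in> A" "(s + t) *\<^sub>R c = s *\<^sub>R a + t *\<^sub>R a'"
      proof (cases "s + t = 0")
        case True
        with st have "s = 0" "t = 0" by auto
        with that[of a] st show ?thesis by simp
      next
        case False
        with st have "0 < s + t" by simp
        then have "(s / (s + t)) *\<^sub>R a + (t / (s + t)) *\<^sub>R a' \<in> A"
          using st A(1) by (intro convexD) (auto simp flip: add_divide_distrib)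
        with that False show ?thesis by (simp add: scaleR_add_right)
      qed
      have "(x + y) + (s + t) *\<^sub>R (b - c) = (x + s *\<^sub>R (b - a)) + (y + t *\<^sub>R (b - a'))"
        using c(2) by (simp add: algebra_simps)
      then have "\<Phi> (x + y) (s + t) c \<le> \<Phi> x s a + \<Phi> y t a'"
        using norm_triangle_ineq[of "x + s *\<^sub>R (b - a)" "y + t *\<^sub>R (b - a')"]
        by (simp add: \<Phi>_def algebra_simps)
      then show ?thesis using p_le[of "s + t" c "x + y"] st c by simp
    qed
    then have "p (x + y) - \<Phi> y t a' \<le> p x" if "0 \<le> t" "a' \<in> A" for t a'
      using that by (intro p_ge)
    then have "p (x + y) - p x \<le> p y"
      by (intro p_ge) (simp add: algebra_simps)
    then show "p (x + y) \<le> p x + p y" by simp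
  next
    fix c :: real and x assume c: "0 < c"
    have "p (c *\<^sub>R x) / c \<le> \<Phi> x s a" if "0 \<le> s" "a \<in> A" for s a
    proof -
      have "c *\<^sub>R x + (c * s) *\<^sub>R (b - a) = c *\<^sub>R (x + s *\<^sub>R (b - a))"
        by (simp add: scaleR_add_right)
      then have "\<Phi> (c *\<^sub>R x) (c * s) a = c * \<Phi> x s a"
        using c by (simp add: \<Phi>_def right_diff_distrib)
      then show ?thesis
        using p_le[of "c * s" a "c *\<^sub>R x"] c that by (simp add: field_simps)
    qed
    then have "p (c *\<^sub>R x) / c \<le> p x" by (rule p_ge)
    then show "p (c *\<^sub>R x) \<le> c * p x" using c by (simp add: field_simps)
  qed
  then obtain f where f: "linear f" "\<And>x. f x \<le> p x"
    using hahn_banach_sublinear by blast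
  interpret linear f by fact
  obtain a0 where a0: "a0 \<in> A" using A(2) by blast
  have f_le: "f x \<le> norm x" for x
    using f(2)[of x] p_le[of 0 a0 x] a0 by (simp add: \<Phi>_def)
  have f_abs: "\<bar>f x\<bar> \<le> norm x" for x
    using f_le[of x] f_le[of "- x"] by (simp add: neg)
  have bl: "bounded_linear f"
    using f_abs by (intro bounded_linear_intro[of _ 1]) (auto simp: add scale)
  have "norm (Blinfun f) \<le> 1"
    using f_abs by (intro norm_blinfun_bound) (auto simp: bounded_linear_Blinfun_apply[OF bl])
  then have w: "dual_apply (Abs_dual_ball (Blinfun f)) = f"
    by (subst Abs_dual_ball_inverse) (auto simp: bounded_linear_Blinfun_apply[OF bl])
  show ?thesis
  proof (rule that)
    fix a assume a: "a \<in> A"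
    have "f (a - b) \<le> - \<delta>"
      using f(2)[of "a - b"] p_le[of 1 a "a - b"] a by (simp add: \<Phi>_def)
    then show "dual_apply (Abs_dual_ball (Blinfun f)) a + \<delta> \<le> dual_apply (Abs_dual_ball (Blinfun f)) b"
      by (simp add: w diff)
  qed
qed

text \<open>Separating \<open>x\<close> from \<open>{0}\<close> with the gap \<open>norm x\<close>
  gives one inequality, the dual ball bound the other.\<close>

lemma dual_ball_norming:
  fixes x :: "'a::real_normed_vector"
  obtains w where "dual_apply w x = norm x"
proof -
  obtain w where "norm x \<le> dual_apply w x"
    using dual_ball_separation[of "{0}" "norm x" x] by (auto simp: blinfun.zero_right)
  with dual_ball_le_norm[of w x] have "dual_apply w x = norm x" by simp
  with that show ?thesis .
qed

section \<open>Continuity and Jensen inequality for convex measures of non-property\<close>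

lemma bounded_sets_combination:
  assumes "A \<in> bounded_sets" "B \<in> bounded_sets"
  shows "(\<lambda>x. u *\<^sub>R x) ` A + (\<lambda>x. v *\<^sub>R x) ` B \<in> bounded_sets"
proof -
  have "bounded ((\<lambda>(x, y). x + y) ` ((\<lambda>x. u *\<^sub>R x) ` A \<times> (\<lambda>x. v *\<^sub>R x) ` B))"
    using assms by (intro bounded_plus bounded_scaling) (auto simp: bounded_sets_def)
  with assms show ?thesis
    by (simp add: bounded_sets_def set_plus_image)
qed

context convex_measure_of_nonproperty
begin

text \<open>Each \<open>a\<close> is a convex combination of a neighbour in \<open>B\<close> and a
  point of a larger ball, with weight \<open>2 * \<delta>\<close> on the ball; then
  \<open>mono\<close> and \<open>convexity\<close> apply.\<close>

lemma measure_le_of_near: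
  assumes A: "A \<noteq> {}" and B: "B \<noteq> {}" "B \<subseteq> cball 0 R" and \<delta>: "0 \<le> \<delta>" "\<delta> \<le> 1 / 2"
    and near: "\<And>a. a \<in> A \<Longrightarrow> \<exists>b\<in>B. norm (a - b) \<le> \<delta>"
  shows "\<mu> A \<le> \<mu> B + 2 * \<delta> * \<mu> (cball 0 (R + 1))"
proof -
  have R: "0 \<le> R" using B by (force intro: order_trans[OF norm_ge_zero])
  have K: "cball 0 (R + 1) \<in> bounded_sets" using R by (auto simp: bounded_sets_def)
  have Bb: "B \<in> bounded_sets"
    using B by (auto simp: bounded_sets_def intro: bounded_subset[OF bounded_cball])
  let ?S = "(\<lambda>x. (1 - 2 * \<delta>) *\<^sub>R x) ` B + (\<lambda>x. (1 - (1 - 2 * \<delta>)) *\<^sub>R x) ` cball 0 (R + 1)"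
  have sub: "A \<subseteq> ?S"
  proof
    fix a assume "a \<in> A"
    then obtain b where b: "b \<in> B" "norm (a - b) \<le> \<delta>" using near by blast
    \<comment> \<open>Solves \<open>a = (1 - 2 * \<delta>) b + 2 * \<delta> v\<close>; the
      correction to \<open>b\<close> has norm at most 1. If \<open>\<delta> = 0\<close>, then
      \<open>a = b\<close> and \<open>v\<close> has weight 0.\<close>
    define v where "v = (if \<delta> = 0 then 0 else b + (1 / (2 * \<delta>)) *\<^sub>R (a - b))"
    have "norm v \<le> R + 1"
    proof (cases "\<delta> = 0")
      case False
      have "norm v \<le> norm b + norm ((1 / (2 * \<delta>)) *\<^sub>R (a - b))"
        using False norm_triangle_ineq by (simp only: v_def if_False)
      also have "norm ((1 / (2 * \<delta>)) *\<^sub>R (a - b)) \<le> 1"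
        using b(2) \<delta>(1) False by (simp add: divide_le_eq)
      finally show ?thesis using b(1) B(2) by force
    qed (use R in \<open>simp add: v_def\<close>)
    moreover have "a = (1 - 2 * \<delta>) *\<^sub>R b + (1 - (1 - 2 * \<delta>)) *\<^sub>R v"
    proof (cases "\<delta> = 0")
      case True
      with b(2) show ?thesis by simp
    next
      case False
      then show ?thesis by (simp add: v_def scaleR_add_right scaleR_left_diff_distrib)
    qed
    ultimately show "a \<in> ?S"
      using b(1) by (auto intro!: set_plus_intro)
  qed
  have Sb: "?S \<in> bounded_sets"
    by (intro bounded_sets_combination Bb K)
  then have "A \<in> bounded_sets"
    using A sub by (auto simp: bounded_sets_def intro: bounded_subset)
  then have "\<mu> A \<le> \<mu> ?S" using Sb sub by (intro mono)
  also have "\<dots> \<le> (1 - 2 * \<delta>) * \<mu> B + (1 - (1 - 2 * \<delta>)) * \<mu> (cball 0 (R + 1))"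
    using \<delta> by (intro convexity Bb K) auto
  also have "\<dots> \<le> \<mu> B + 2 * \<delta> * \<mu> (cball 0 (R + 1))"
    using nonneg[OF Bb] \<delta>(1) by (simp add: left_diff_distrib)
  finally show ?thesis .
qed

text \<open>By separation, domination of the support functions up to \<open>\<delta>\<close> puts \<open>A\<close> into the
  \<open>\<delta>\<close>-neighbourhood of the convex hull of \<open>B\<close>.\<close>

lemma measure_le_of_support_le:
  assumes A: "A \<noteq> {}" and B: "B \<noteq> {}" "B \<subseteq> cball 0 R" and \<delta>: "0 \<le> \<delta>" "\<delta> \<le> 1 / 2"
    and supp: "\<And>a w. a \<in> A \<Longrightarrow> \<exists>b\<in>B. dual_apply w a < dual_apply w b + \<delta>"
  shows "\<mu> A \<le> \<mu> B + 2 * \<delta> * \<mu> (cball 0 (R + 1))"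
proof -
  have "\<mu> A \<le> \<mu> (convex hull B) + 2 * \<delta> * \<mu> (cball 0 (R + 1))"
  proof (rule measure_le_of_near[OF A _ _ \<delta>])
    show "convex hull B \<noteq> {}" "convex hull B \<subseteq> cball 0 R"
      using B by (auto simp: hull_minimal subset_hull)
    show "\<exists>b\<in>convex hull B. norm (a - b) \<le> \<delta>" if a: "a \<in> A" for a
    proof (rule ccontr)
      assume far: "\<not> ?thesis"
      have "\<exists>w. \<forall>b\<in>convex hull B. dual_apply w b + \<delta> \<le> dual_apply w a"
        by (rule dual_ball_separation[OF convex_convex_hull, of B \<delta> a])
          (use far B(1) in \<open>force+\<close>)
      then obtain w where w: "\<forall>b\<in>convex hull B. dual_apply w b + \<delta> \<le> dual_apply w a" ..
      \<comment> \<open>The strict inequality in \<open>supp\<close> contradicts a gap of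
        \<open>\<delta>\<close> over the hull, which contains \<open>B\<close>.\<close>
      show False
        using supp[OF a, of w] w by (meson hull_inc not_less)
    qed
  qed
  moreover have "B \<in> bounded_sets"
    using B by (auto simp: bounded_sets_def intro: bounded_subset[OF bounded_cball])
  ultimately show ?thesis by (simp add: convex_hull)
qed

text \<open>Serves to apply \<open>mono\<close>, which speaks only of members of
  \<open>bounded_sets\<close>, to the weighted sums in Jensen's inequality.\<close>

lemma bounded_sets_weighted_sum:
  fixes A :: "'i \<Rightarrow> 'a set"
  assumes "finite I" "\<And>i. i \<in> I \<Longrightarrow> A i \<in> bounded_sets" "C \<in> bounded_sets"
  shows "{(\<Sum>i\<in>I. u i *\<^sub>R x i) + r *\<^sub>R y | x y. (\<forall>i\<in>I. x i \<in> A i) \<and> y \<in> C} \<in> bounded_sets"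
    (is "?W \<in> _")
proof -
  have "\<forall>i\<in>I. \<exists>K. \<forall>x\<in>A i. norm x \<le> K" "\<forall>i\<in>I. \<exists>x. x \<in> A i"
    using assms(2) by (auto simp: bounded_sets_def bounded_iff)
  then obtain K z where K: "\<And>i x. i \<in> I \<Longrightarrow> x \<in> A i \<Longrightarrow> norm x \<le> K i"
    and z: "\<forall>i\<in>I. z i \<in> A i" by metis
  obtain L c where L: "\<And>y. y \<in> C \<Longrightarrow> norm y \<le> L" and c: "c \<in> C"
    using assms(3) by (auto simp: bounded_sets_def bounded_iff)
  have "norm ((\<Sum>i\<in>I. u i *\<^sub>R x i) + r *\<^sub>R y) \<le> (\<Sum>i\<in>I. \<bar>u i\<bar> * K i) + \<bar>r\<bar> * L"
    if "\<forall>i\<in>I. x i \<in> A i" "y \<in> C" for x y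
    using that K L
    by (intro norm_triangle_le add_mono sum_norm_le) (auto intro!: mult_left_mono)
  then have "bounded ?W" by (force simp: bounded_iff)
  moreover have "?W \<noteq> {}" using z c by auto
  ultimately show ?thesis by (simp add: bounded_sets_def)
qed

text \<open>The total weight may stay below 1, with the rest carried by \<open>C\<close>. Leaving
  \<open>C\<close> arbitrary drives the induction: a new index \<open>j\<close> is absorbed into the
  remainder set, at the cost of one use of \<open>convexity\<close>.\<close>

lemma jensen:
  fixes A :: "'i \<Rightarrow> 'a set" and u :: "'i \<Rightarrow> real"
  assumes "finite I" "\<And>i. i \<in> I \<Longrightarrow> A i \<in> bounded_sets" "\<And>i. i \<in> I \<Longrightarrow> 0 \<le> u i"
    "sum u I \<le> 1" "C \<in> bounded_sets"
  shows "\<mu> {(\<Sum>i\<in>I. u i *\<^sub>R x i) + (1 - sum u I) *\<^sub>R y | x y. (\<forall>i\<in>I. x i \<in> A i) \<and> y \<in> C}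
    \<le> (\<Sum>i\<in>I. u i * \<mu> (A i)) + (1 - sum u I) * \<mu> C"
  using assms
proof (induction I arbitrary: C rule: finite_induct)
  case empty
  then show ?case by simp
next
  case (insert j I)
  let ?\<sigma> = "sum u I"
  \<comment> \<open>The share of \<open>A j\<close> in the remainder weight
    \<open>1 - ?\<sigma>\<close>. If \<open>?\<sigma> = 1\<close>, then \<open>u j = 0\<close>, and
    division by zero yields the fitting value 0.\<close>
  define v where "v = u j / (1 - ?\<sigma>)"
  have \<sigma>: "u j + ?\<sigma> \<le> 1" "0 \<le> u j" "?\<sigma> \<le> 1"
    using insert.prems(2)[of j] insert.prems(3) insert.hyps by auto
  have v: "0 \<le> v" "v \<le> 1" "(1 - ?\<sigma>) * v = u j"
    using \<sigma> by (cases "?\<sigma> = 1"; simp add: v_def divide_le_eq)+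
  have v': "(1 - ?\<sigma>) * (1 - v) = 1 - sum u (insert j I)"
    using v(3) insert.hyps by (simp add: right_diff_distrib)
  define C' where "C' = (\<lambda>x. v *\<^sub>R x) ` A j + (\<lambda>x. (1 - v) *\<^sub>R x) ` C"
  have Aj: "A j \<in> bounded_sets" and C: "C \<in> bounded_sets" using insert.prems by auto
  have C': "C' \<in> bounded_sets"
    unfolding C'_def by (intro bounded_sets_combination Aj C)
  let ?W = "{(\<Sum>i\<in>insert j I. u i *\<^sub>R x i) + (1 - sum u (insert j I)) *\<^sub>R y | x y.
    (\<forall>i\<in>insert j I. x i \<in> A i) \<and> y \<in> C}"
  let ?W' = "{(\<Sum>i\<in>I. u i *\<^sub>R x i) + (1 - ?\<sigma>) *\<^sub>R y | x y. (\<forall>i\<in>I. x i \<in> A i) \<and> y \<in> C'}"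
  have "?W \<subseteq> ?W'"
  proof clarify
    fix x y assume xy: "\<forall>i\<in>insert j I. x i \<in> A i" "y \<in> C"
    have "(\<Sum>i\<in>insert j I. u i *\<^sub>R x i) + (1 - sum u (insert j I)) *\<^sub>R y
      = (\<Sum>i\<in>I. u i *\<^sub>R x i) + (1 - ?\<sigma>) *\<^sub>R (v *\<^sub>R x j + (1 - v) *\<^sub>R y)"
      using insert.hyps v(3) v' by (simp add: scaleR_add_right)
    moreover have "v *\<^sub>R x j + (1 - v) *\<^sub>R y \<in> C'"
      using xy by (auto simp: C'_def set_plus_def)
    ultimately show "\<exists>x' y'. (\<Sum>i\<in>insert j I. u i *\<^sub>R x i) + (1 - sum u (insert j I)) *\<^sub>R y
      = (\<Sum>i\<in>I. u i *\<^sub>R x' i) + (1 - ?\<sigma>) *\<^sub>R y' \<and> (\<forall>i\<in>I. x' i \<in> A i) \<and> y' \<in> C'"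
      using xy(1) by blast
  qed
  then have "\<mu> ?W \<le> \<mu> ?W'"
    using insert.hyps insert.prems C' by (intro mono bounded_sets_weighted_sum) auto
  also have "\<dots> \<le> (\<Sum>i\<in>I. u i * \<mu> (A i)) + (1 - ?\<sigma>) * \<mu> C'"
    using insert.prems \<sigma>(3) C' by (intro insert.IH) auto
  also have "(1 - ?\<sigma>) * \<mu> C' \<le> (1 - ?\<sigma>) * (v * \<mu> (A j) + (1 - v) * \<mu> C)"
    unfolding C'_def using \<sigma>(3) v Aj C by (intro mult_left_mono convexity) auto
  also have "\<dots> = u j * \<mu> (A j) + (1 - sum u (insert j I)) * \<mu> C"
    by (simp add: distrib_left flip: mult.assoc v(3) v')
  finally show ?case using insert.hyps by simp
qed

text \<open>Some member of \<open>\<D>\<close> contains 0, and \<open>hereditary\<close> applies to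
  its subset \<open>{0}\<close>. Thus \<open>{0}\<close> is a free remainder set in Jensen's
  inequality.\<close>

lemma measure_zero:
  assumes "fundamental_subsemigroup \<D>"
  shows "\<mu> {0} = 0"
proof -
  interpret fundamental_subsemigroup \<D> by fact
  obtain D where "D \<in> \<D>" "0 \<in> D" using covers by blast
  then show ?thesis
    using hereditary[of "{0}" D] zero_iff[of "{0}"] by (simp add: bounded_sets_def)
qed

end

section \<open>Support functions and strong measurability\<close>

lemma dual_ball_le_norm_trans: "norm x \<le> K \<Longrightarrow> dual_apply w x \<le> K"
  using dual_ball_le_norm[of w x] by linarith

lemma support_fun_upper:
  fixes G :: "(real \<Rightarrow> 'a::real_normed_vector) set"
  assumes "bounded {g x | g. g \<in> G}" "g \<in> G"
  shows "dual_apply w (g x) \<le> apply_bcontfun (support_fun G x) w"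
proof -
  obtain K where K: "\<And>g. g \<in> G \<Longrightarrow> norm (g x) \<le> K"
    using assms(1) by (auto simp: bounded_iff)
  have "bdd_above ((\<lambda>g. dual_apply w (g x)) ` G)"
    by (intro bdd_aboveI2[where M=K] dual_ball_le_norm_trans K)
  moreover have "apply_bcontfun (support_fun G x) w = (SUP g\<in>G. dual_apply w (g x))"
    using assms by (intro apply_support_fun) auto
  ultimately show ?thesis
    using cSUP_upper[OF assms(2)] by metis
qed

lemma support_fun_dist:
  fixes G :: "(real \<Rightarrow> 'a::real_normed_vector) set"
  shows "apply_bcontfun (support_fun G y) w
    \<le> apply_bcontfun (support_fun G x) w + dist (support_fun G y) (support_fun G x)"
  using dist_bounded[of "support_fun G y" w "support_fun G x"] by (simp add: dist_real_def)

text \<open>An \<open>h\<close> that almost attains the supremum at \<open>x\<close> in the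
  direction \<open>w\<close> is chosen before \<open>g\<close> and \<open>y\<close>, so one witness
  serves all nearby sections.\<close>

lemma support_fun_approx:
  fixes G :: "(real \<Rightarrow> 'a::real_normed_vector) set"
  assumes G: "G \<noteq> {}" "bounded {g x | g. g \<in> G}" and e: "0 < e"
  obtains h where "h \<in> G" "\<And>g y. g \<in> G \<Longrightarrow> bounded {g y | g. g \<in> G} \<Longrightarrow>
    dual_apply w (g y) < dual_apply w (h x) + dist (support_fun G y) (support_fun G x) + e"
proof -
  have "apply_bcontfun (support_fun G x) w - e < (SUP g\<in>G. dual_apply w (g x))"
    using e by (simp add: apply_support_fun[OF G])
  then obtain h where h: "h \<in> G" "apply_bcontfun (support_fun G x) w - e < dual_apply w (h x)"
    using less_cSupD[of "(\<lambda>g. dual_apply w (g x)) ` G"] G(1) by blast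
  show ?thesis
  proof (rule that[OF h(1)])
    fix g y assume "g \<in> G" "bounded {g y | g. g \<in> G}"
    then show "dual_apply w (g y) < dual_apply w (h x) + dist (support_fun G y) (support_fun G x) + e"
      using support_fun_upper[of y G g w] support_fun_dist[of G y w x] h(2) by linarith
  qed
qed

text \<open>A functional norming \<open>g y\<close> turns closeness of support functions into a norm
  bound.\<close>

lemma support_fun_norm_le:
  fixes G :: "(real \<Rightarrow> 'a::real_normed_vector) set"
  assumes G: "G \<noteq> {}" and y: "bounded {g y | g. g \<in> G}" and x: "\<And>g. g \<in> G \<Longrightarrow> norm (g x) \<le> R"
    and g: "g \<in> G"
  shows "norm (g y) \<le> R + dist (support_fun G y) (support_fun G x)"
proof -
  have bx: "bounded {g x | g. g \<in> G}" using x by (auto simp: bounded_iff)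
  obtain w where w: "dual_apply w (g y) = norm (g y)" by (rule dual_ball_norming)
  have "apply_bcontfun (support_fun G x) w \<le> R"
    unfolding apply_support_fun[OF G bx]
    by (intro cSUP_least G dual_ball_le_norm_trans x)
  then show ?thesis
    using support_fun_upper[OF y g, of w] support_fun_dist[of G y w x] w by linarith
qed

text \<open>Domination of support functions up to \<open>\<delta> / c\<close> becomes domination up
  to \<open>\<delta>\<close> after scaling by \<open>c\<close>; comparing in both directions gives
  convergence.\<close>

lemma (in convex_measure_of_nonproperty) continuous_along_support_fun:
  fixes G :: "(real \<Rightarrow> 'a) set"
  assumes G: "G \<noteq> {}" and c: "0 < c"
    and x: "bounded {g x | g. g \<in> G}" and y: "\<And>k. bounded {g (y k) | g. g \<in> G}"
    and lim: "(\<lambda>k. support_fun G (y k)) \<longlonglongrightarrow> support_fun G x"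
  shows "(\<lambda>k. \<mu> {c *\<^sub>R g (y k) | g. g \<in> G}) \<longlonglongrightarrow> \<mu> {c *\<^sub>R g x | g. g \<in> G}"
proof -
  define F where "F z = \<mu> {c *\<^sub>R g z | g. g \<in> G}" for z
  obtain R where R: "\<And>g. g \<in> G \<Longrightarrow> norm (g x) \<le> R"
    using x by (auto simp: bounded_iff)
  \<comment> \<open>Nearby sections have norm at most \<open>R + 1\<close>, which \<open>c\<close>
    scales; the last 1 is the enlargement of the radius in
    \<open>measure_le_of_support_le\<close>.\<close>
  define L where "L = \<mu> (cball 0 (c * (R + 1) + 1))"
  have compare: "F u \<le> F v + 2 * \<delta> * L"
    if u: "bounded {g u | g. g \<in> G}" and v: "\<And>g. g \<in> G \<Longrightarrow> norm (g v) \<le> R + 1"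
      and \<delta>: "0 < \<delta>" "\<delta> \<le> 1 / 2" and d: "dist (support_fun G u) (support_fun G v) < \<delta> / c" for u v \<delta>
    unfolding F_def L_def
  proof (rule measure_le_of_support_le)
    show "{c *\<^sub>R g u | g. g \<in> G} \<noteq> {}" "{c *\<^sub>R g v | g. g \<in> G} \<noteq> {}" using G by auto
    show "{c *\<^sub>R g v | g. g \<in> G} \<subseteq> cball 0 (c * (R + 1))"
      using v c by auto
    fix a w assume "a \<in> {c *\<^sub>R g u | g. g \<in> G}"
    then obtain g where g: "g \<in> G" "a = c *\<^sub>R g u" by blast
    have "bounded {g v | g. g \<in> G}" using v by (auto simp: bounded_iff)
    \<comment> \<open>The slack is chosen so that the distance cancels and exactly
      \<open>\<delta> / c\<close> remains.\<close>
    from support_fun_approx[OF G this, of "\<delta> / c - dist (support_fun G u) (support_fun G v)" w] d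
    obtain h where h: "h \<in> G" "\<And>g y. g \<in> G \<Longrightarrow> bounded {g y | g. g \<in> G} \<Longrightarrow> dual_apply w (g y)
        < dual_apply w (h v) + dist (support_fun G y) (support_fun G v)
          + (\<delta> / c - dist (support_fun G u) (support_fun G v))"
      by auto
    have "dual_apply w (g u) < dual_apply w (h v) + \<delta> / c"
      using h(2)[OF g(1) u] by simp
    then have "c * dual_apply w (g u) < c * dual_apply w (h v) + \<delta>"
      using c by (simp add: field_simps)
    then show "\<exists>b\<in>{c *\<^sub>R g v | g. g \<in> G}. dual_apply w a < dual_apply w b + \<delta>"
      using h(1) g(2) by (auto simp: blinfun.scaleR_right)
  qed (use \<delta> in auto)
  have "(\<lambda>k. F (y k)) \<longlonglongrightarrow> F x"
  proof (rule LIMSEQ_I)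
    fix e :: real assume e: "0 < e"
    define \<delta> where "\<delta> = min (1 / 2) (e / (2 * (\<bar>L\<bar> + 1)))"
    have \<delta>: "0 < \<delta>" "\<delta> \<le> 1 / 2"
      using e min.cobounded1[of "1 / 2" "e / (2 * (\<bar>L\<bar> + 1))"] by (auto simp: \<delta>_def)
    have "\<delta> * (2 * (\<bar>L\<bar> + 1)) \<le> e"
      using min.cobounded2[of "1 / 2" "e / (2 * (\<bar>L\<bar> + 1))"]
      unfolding \<delta>_def by (subst (asm) pos_le_divide_eq) auto
    moreover have "\<delta> * L \<le> \<delta> * \<bar>L\<bar>"
      using \<delta>(1) by (intro mult_left_mono) auto
    moreover have "\<delta> * (2 * (\<bar>L\<bar> + 1)) = 2 * (\<delta> * \<bar>L\<bar>) + 2 * \<delta>"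
      by (simp add: algebra_simps)
    ultimately have small: "2 * \<delta> * L < e"
      using \<delta>(1) by linarith
    \<comment> \<open>Distance below 1 gives the norm bound \<open>R + 1\<close>, distance below
      \<open>\<delta> / c\<close> the comparison.\<close>
    obtain k0 where k0: "\<And>k. k0 \<le> k \<Longrightarrow> dist (support_fun G (y k)) (support_fun G x) < min 1 (\<delta> / c)"
      using lim[THEN metric_LIMSEQ_D, of "min 1 (\<delta> / c)"] \<delta>(1) c by auto
    have "norm (F (y k) - F x) < e" if k: "k0 \<le> k" for k
    proof -
      have "norm (g (y k)) \<le> R + 1" if "g \<in> G" for g
      proof -
        have "norm (g (y k)) \<le> R + dist (support_fun G (y k)) (support_fun G x)"
          by (intro support_fun_norm_le G y R that)
        with k0[OF k] show ?thesis by simp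
      qed
      then have "F x \<le> F (y k) + 2 * \<delta> * L"
        using k0[OF k] by (intro compare x \<delta>) (auto simp: dist_commute)
      moreover have "F (y k) \<le> F x + 2 * \<delta> * L"
        using k0[OF k] R by (intro compare y \<delta>) (force dest: R)+
      ultimately show ?thesis using small by simp
    qed
    then show "\<exists>k0. \<forall>k\<ge>k0. norm (F (y k) - F x) < e" by blast
  qed
  then show ?thesis by (simp add: F_def)
qed

section \<open>Measurability on complete measure spaces\<close>

lemma complete_measure_lebesgue_on:
  assumes "S \<in> sets lebesgue"
  shows "complete_measure (lebesgue_on S)"
proof
  fix A B assume "B \<subseteq> A" "A \<in> null_sets (lebesgue_on S)"
  moreover from this have "B \<in> null_sets lebesgue"
    using completion.complete2[of B A lborel] by (simp add: null_sets_restrict_space[OF assms])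
  ultimately have "B \<in> null_sets (lebesgue_on S)"
    by (auto simp: null_sets_restrict_space[OF assms])
  then show "B \<in> sets (lebesgue_on S)" by auto
qed

text \<open>Preimages under \<open>f\<close> and \<open>g\<close> agree almost everywhere, and
  completeness makes the second measurable along with the first.\<close>

lemma (in complete_measure) measurable_AE_cong:
  assumes f: "f \<in> borel_measurable M" and eq: "AE x in M. f x = g x"
  shows "g \<in> borel_measurable M"
proof (rule measurableI)
  fix A :: "'b set" assume "A \<in> sets borel"
  with f have "f -` A \<inter> space M \<in> sets M" by (rule measurable_sets)
  moreover have ae: "AE x in M. x \<in> f -` A \<inter> space M \<longleftrightarrow> x \<in> g -` A \<inter> space M"
    using eq by eventually_elim auto
  ultimately show "g -` A \<inter> space M \<in> sets M"
    using in_sets_AE[OF ae] by blast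
qed simp

lemma (in complete_measure) borel_measurable_AE_limit:
  fixes f :: "nat \<Rightarrow> 'a \<Rightarrow> real"
  assumes "\<And>n. f n \<in> borel_measurable M" "AE x in M. (\<lambda>n. f n x) \<longlonglongrightarrow> g x"
  shows "g \<in> borel_measurable M"
proof (rule measurable_AE_cong)
  show "(\<lambda>x. lim (\<lambda>n. f n x)) \<in> borel_measurable M"
    using assms(1) by (rule borel_measurable_lim_metric)
  show "AE x in M. lim (\<lambda>n. f n x) = g x"
    using assms(2) by eventually_elim (rule limI)
qed

text \<open>\<open>F\<close> is the almost everywhere limit of the simple functions \<open>x \<mapsto> F (p n (s n x))\<close>, where
  \<open>s n\<close> are simple functions converging to \<open>J\<close> and \<open>p n c\<close> is a point of \<open>S\<close> at which \<open>J\<close> is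
  almost as close to \<open>c\<close> as possible.\<close>

lemma (in complete_measure) borel_measurable_along_strongly_measurable:
  fixes J :: "'a \<Rightarrow> 'b::real_normed_vector" and F :: "'a \<Rightarrow> real"
  assumes J: "strongly_measurable M J" and S: "AE x in M. x \<in> S"
    and cont: "\<And>x y. x \<in> S \<Longrightarrow> (\<And>k. y k \<in> S) \<Longrightarrow> (\<lambda>k. J (y k)) \<longlonglongrightarrow> J x \<Longrightarrow>
      (\<lambda>k. F (y k)) \<longlonglongrightarrow> F x"
  shows "F \<in> borel_measurable M"
proof -
  obtain s where s: "\<And>n. simple_function M (s n)" "AE x in M. (\<lambda>n. s n x) \<longlonglongrightarrow> J x"
    using J by (auto simp: strongly_measurable_def)
  define near where "near n c y \<longleftrightarrow> y \<in> S \<and> dist c (J y) < infdist c (J ` S) + inverse (real (Suc n))" for n c y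
  define p where "p n c = (SOME y. near n c y)" for n c
  have p: "near n c (p n c)" if ne: "S \<noteq> {}" for n c
  proof -
    have "(INF b\<in>J ` S. dist c b) < infdist c (J ` S) + inverse (real (Suc n))"
      using ne by (simp add: infdist_def)
    then obtain b where "b \<in> J ` S" "dist c b < infdist c (J ` S) + inverse (real (Suc n))"
      using ne cINF_less_iff[of "J ` S" "dist c"] by auto
    then have "\<exists>y. near n c y" by (auto simp: near_def)
    then show ?thesis unfolding p_def by (rule someI_ex)
  qed
  show ?thesis
  proof (rule borel_measurable_AE_limit)
    show "(\<lambda>x. F (p n (s n x))) \<in> borel_measurable M" for n
      \<comment> \<open>A simple function followed by any map is simple; the two-argument
        composition rule is used with its second argument ignored.\<close>
      by (rule borel_measurable_simple_function)
        (rule simple_function_compose2[OF s(1) s(1), of "\<lambda>c _. F (p n c)"])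
    show "AE x in M. (\<lambda>n. F (p n (s n x))) \<longlonglongrightarrow> F x"
      using s(2) S
    proof eventually_elim
      case (elim x)
      then have near: "near n (s n x) (p n (s n x))" for n
        using p by blast
      \<comment> \<open>As \<open>x\<close> lies in \<open>S\<close>, \<open>J x\<close> competes in
        the infimum; the triangle inequality through \<open>s n x\<close> doubles the
        distance.\<close>
      have "dist (J (p n (s n x))) (J x) \<le> 2 * dist (s n x) (J x) + inverse (real (Suc n))" for n
      proof -
        have "infdist (s n x) (J ` S) \<le> dist (s n x) (J x)"
          using elim(2) by (intro infdist_le) auto
        then show ?thesis
          using near[of n] dist_triangle2[of "J (p n (s n x))" "J x" "s n x"]
          by (simp add: near_def dist_commute)
      qed
      then have bound: "\<forall>n. norm (dist (J (p n (s n x))) (J x)) \<le> 2 * dist (s n x) (J x) + inverse (real (Suc n))"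
        by simp
      have "(\<lambda>n. dist (s n x) (J x)) \<longlonglongrightarrow> 0"
        using elim(1) by (rule tendsto_dist_iff[THEN iffD1])
      then have "(\<lambda>n. 2 * dist (s n x) (J x) + inverse (real (Suc n))) \<longlonglongrightarrow> 2 * 0 + 0"
        by (intro tendsto_add tendsto_mult_left LIMSEQ_inverse_real_of_nat)
      then have "(\<lambda>n. dist (J (p n (s n x))) (J x)) \<longlonglongrightarrow> 0"
        by (intro Lim_null_comparison[OF always_eventually[OF bound]]) simp
      then have "(\<lambda>n. J (p n (s n x))) \<longlonglongrightarrow> J x"
        by (rule tendsto_dist_iff[THEN iffD2])
      moreover have "p n (s n x) \<in> S" for n
        using near[of n] by (simp add: near_def)
      ultimately show ?case
        using elim(2) by (intro cont)
    qed
  qed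
qed

text \<open>An approximating simple function is within \<open>e / 2\<close> of \<open>J\<close> on
  \<open>Z n\<close>, so \<open>J\<close> oscillates by less than \<open>e\<close> on each of its
  fibres there. Almost every point is in \<open>Z n\<close> for all large \<open>n\<close>, so
  dominated convergence makes the integral of \<open>\<psi>\<close> over the complement
  small.\<close>

lemma (in finite_measure) strongly_measurable_partition:
  fixes J :: "'a \<Rightarrow> 'b::real_normed_vector" and \<psi> :: "'a \<Rightarrow> real"
  assumes J: "strongly_measurable M J" and S: "AE x in M. x \<in> S"
    and \<psi>: "integrable M \<psi>" and e: "0 < e"
  obtains \<E> where "finite \<E>" "disjoint \<E>" "\<E> \<subseteq> sets M" "{} \<notin> \<E>" "\<Union>\<E> \<subseteq> S"
    "\<forall>E\<in>\<E>. \<forall>x\<in>E. \<forall>y\<in>E. dist (J x) (J y) < e"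
    "(\<integral>x. \<psi> x * indicator (space M - \<Union>\<E>) x \<partial>M) < e"
proof -
  obtain s where s: "\<And>n. simple_function M (s n)" "AE x in M. (\<lambda>n. s n x) \<longlonglongrightarrow> J x"
    using J by (auto simp: strongly_measurable_def)
  \<comment> \<open>A Borel representative of the distance makes \<open>Z n\<close> measurable; the
    null set \<open>N\<close> collects the exceptional points.\<close>
  have "\<exists>h. h \<in> borel_measurable M \<and> (AE x in M. norm (J x - s n x) = h x)" for n
    using strongly_measurable_norm_diff_AE[OF J s(1)] by metis
  then obtain h where h: "\<And>n. h n \<in> borel_measurable M" "\<And>n. AE x in M. norm (J x - s n x) = h n x"
    by metis
  have "AE x in M. x \<in> S \<and> (\<lambda>n. s n x) \<longlonglongrightarrow> J x \<and> (\<forall>n. norm (J x - s n x) = h n x)"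
    using S s(2) h(2) by (simp add: AE_all_countable AE_conj_iff)
  from this obtain N where N: "N \<in> null_sets M" "\<And>x. x \<in> space M - N \<Longrightarrow>
      x \<in> S \<and> (\<lambda>n. s n x) \<longlonglongrightarrow> J x \<and> (\<forall>n. norm (J x - s n x) = h n x)"
    by (rule AE_E3) blast
  define Z where "Z n = {x \<in> space M. h n x < e / 2} - N" for n
  have Z: "Z n \<in> sets M" for n
    using h(1) null_setsD2[OF N(1)] unfolding Z_def by measurable
  have "(\<lambda>n. \<integral>x. \<psi> x * indicator (space M - Z n) x \<partial>M) \<longlonglongrightarrow> (\<integral>x. 0 \<partial>M)"
  proof (rule integral_dominated_convergence)
    show "integrable M (\<lambda>x. norm (\<psi> x))" using \<psi> by (rule integrable_norm)
    show "(\<lambda>x. \<psi> x * indicator (space M - Z n) x) \<in> borel_measurable M" for n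
      using Z \<psi> by measurable
    show "AE x in M. norm (\<psi> x * indicator (space M - Z n) x) \<le> norm (\<psi> x)" for n
      by (auto simp: indicator_def)
    show "AE x in M. (\<lambda>n. \<psi> x * indicator (space M - Z n) x) \<longlonglongrightarrow> 0"
      using AE_space AE_not_in[OF N(1)]
    proof eventually_elim
      case (elim x)
      then have x: "(\<lambda>n. s n x) \<longlonglongrightarrow> J x" "\<And>n. h n x = norm (J x - s n x)"
        using N(2)[of x] by auto
      have "(\<lambda>n. norm (J x - s n x)) \<longlonglongrightarrow> norm (J x - J x)"
        by (intro tendsto_intros x(1))
      from order_tendstoD(2)[OF this, of "e / 2"]
      have "eventually (\<lambda>n. h n x < e / 2) sequentially"
        using e by (simp add: x(2))
      then have "eventually (\<lambda>n. \<psi> x * indicator (space M - Z n) x = 0) sequentially"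
        by eventually_elim (use elim in \<open>simp add: Z_def\<close>)
      then show ?case by (rule tendsto_eventually)
    qed
  qed simp
  then have "eventually (\<lambda>n. (\<integral>x. \<psi> x * indicator (space M - Z n) x \<partial>M) < e) sequentially"
    using e by (auto elim: order_tendstoD)
  then obtain n where n: "(\<integral>x. \<psi> x * indicator (space M - Z n) x \<partial>M) < e"
    by (auto simp: eventually_sequentially)
  \<comment> \<open>The fibres of \<open>s n\<close> inside \<open>Z n\<close>; empty ones are
    dropped so that every set offers a sampling point.\<close>
  define \<E> where "\<E> = (\<lambda>c. s n -` {c} \<inter> Z n) ` (s n ` space M) - {{}}"
  have U: "\<Union>\<E> = Z n" by (auto simp: \<E>_def Z_def)
  show ?thesis
  proof (rule that)
    show "finite \<E>" using simple_functionD(1)[OF s(1)] by (simp add: \<E>_def)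
    show "disjoint \<E>" by (auto simp: \<E>_def disjoint_def)
    have "s n -` {c} \<inter> Z n = (s n -` {c} \<inter> space M) \<inter> Z n" for c
      by (auto simp: Z_def)
    then show "\<E> \<subseteq> sets M"
      using simple_functionD(2)[OF s(1)] Z by (auto simp: \<E>_def)
    show "{} \<notin> \<E>" by (simp add: \<E>_def)
    show "\<Union>\<E> \<subseteq> S" unfolding U using N(2) by (auto simp: Z_def)
    show "(\<integral>x. \<psi> x * indicator (space M - \<Union>\<E>) x \<partial>M) < e" using n by (simp add: U)
    have dist_c: "norm (J z - s n z) < e / 2" if "z \<in> Z n" for z
      using that N(2)[of z] by (auto simp: Z_def)
    show "\<forall>E\<in>\<E>. \<forall>x\<in>E. \<forall>y\<in>E. dist (J x) (J y) < e"
    proof (intro ballI)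
      fix E x y assume "E \<in> \<E>" "x \<in> E" "y \<in> E"
      then obtain c where c: "s n x = c" "s n y = c" "x \<in> Z n" "y \<in> Z n" by (auto simp: \<E>_def)
      from dist_c[OF c(3)] dist_c[OF c(4)] show "dist (J x) (J y) < e"
        using dist_triangle_half_r[of c "J x" e "J y"] c by (simp add: dist_norm norm_minus_commute)
    qed
  qed
qed

text \<open>By disjointness at most one summand of the step function is nonzero at a point. Every
  later passage from a sum over the partition to an integral uses this comparison.\<close>

lemma (in finite_measure) step_function_integral_le:
  fixes k :: "'a \<Rightarrow> real"
  assumes \<E>: "finite \<E>" "disjoint \<E>" "\<E> \<subseteq> sets M" and k: "integrable M k"
    and le: "AE x in M. (\<forall>E\<in>\<E>. x \<in> E \<longrightarrow> r E \<le> k x) \<and> (x \<notin> \<Union>\<E> \<longrightarrow> 0 \<le> k x)"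
  shows "(\<Sum>E\<in>\<E>. measure M E * r E) \<le> (\<integral>x. k x \<partial>M)"
proof -
  have int: "integrable M (\<lambda>x. indicator E x * r E)" if "E \<in> \<E>" for E
    using that \<E>(3) by (intro integrable_mult_left integrable_real_indicator) (auto simp: less_top[symmetric])
  have "(\<Sum>E\<in>\<E>. measure M E * r E) = (\<Sum>E\<in>\<E>. \<integral>x. indicator E x * r E \<partial>M)"
    using \<E>(3) by (intro sum.cong) (auto dest: sets.sets_into_space simp: Int_absorb2 subset_iff)
  also have "\<dots> = (\<integral>x. (\<Sum>E\<in>\<E>. indicator E x * r E) \<partial>M)"
    using int by (intro Bochner_Integration.integral_sum[symmetric])
  also have "\<dots> \<le> (\<integral>x. k x \<partial>M)"
  proof (rule integral_mono_AE)
    show "AE x in M. (\<Sum>E\<in>\<E>. indicator E x * r E) \<le> k x"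
      using le
    proof eventually_elim
      case (elim x)
      show ?case
      proof (cases "x \<in> \<Union>\<E>")
        case True
        then obtain E where E: "E \<in> \<E>" "x \<in> E" by blast
        then have "indicator E' x * r E' = 0" if "E' \<in> \<E> - {E}" for E'
          using that \<E>(2) by (auto simp: disjoint_def indicator_def)
        then have "(\<Sum>E\<in>\<E>. indicator E x * r E) = (\<Sum>E\<in>{E}. indicator E x * r E)"
          using \<E>(1) E(1) by (intro sum.mono_neutral_right) auto
        with elim E show ?thesis by simp
      next
        case False
        then have "(\<Sum>E\<in>\<E>. indicator E x * r E) = 0"
          by (intro sum.neutral) (auto simp: indicator_def)
        with elim False show ?thesis by simp
      qed
    qed
  qed (use int k in auto)
  finally show ?thesis .
qed

section \<open>Bochner integrals and restriction\<close>

text \<open>Composition with \<open>w\<close> keeps the approximants simple, commutes with their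
  integrals and does not increase distances, since \<open>w\<close> has norm at most 1. Completeness
  gives measurability of the almost everywhere limit.\<close>

lemma (in complete_measure) has_bochner_integral_dual_apply:
  fixes g :: "'a \<Rightarrow> 'b::real_normed_vector"
  assumes "has_Bochner_integral M g y"
  shows "has_bochner_integral M (\<lambda>x. dual_apply w (g x)) (dual_apply w y)"
proof -
  obtain s where s: "\<And>n. Bochner_Integration.simple_bochner_integrable M (s n)"
      "(\<lambda>n. \<integral>\<^sup>+x. ennreal (norm (g x - s n x)) \<partial>M) \<longlonglongrightarrow> 0"
      "(\<lambda>n. Bochner_Integration.simple_bochner_integral M (s n)) \<longlonglongrightarrow> y"
    and g: "strongly_measurable M g"
    using assms by (auto simp: has_Bochner_integral_def)
  show ?thesis
  proof (rule has_bochner_integral.intros)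
    obtain r where r: "\<And>n. simple_function M (r n)" "AE x in M. (\<lambda>n. r n x) \<longlonglongrightarrow> g x"
      using g by (auto simp: strongly_measurable_def)
    show "(\<lambda>x. dual_apply w (g x)) \<in> borel_measurable M"
    proof (rule borel_measurable_AE_limit)
      show "(\<lambda>x. dual_apply w (r n x)) \<in> borel_measurable M" for n
        by (rule borel_measurable_simple_function)
          (rule simple_function_compose2[OF r(1) r(1), of "\<lambda>u _. dual_apply w u"])
      show "AE x in M. (\<lambda>n. dual_apply w (r n x)) \<longlonglongrightarrow> dual_apply w (g x)"
        using r(2) by eventually_elim (intro blinfun.tendsto tendsto_const)
    qed
    show "Bochner_Integration.simple_bochner_integrable M (\<lambda>x. dual_apply w (s n x))" for n
      using simple_bochner_integrable_compose2[OF _ s(1) s(1), of "\<lambda>u _. dual_apply w u"]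
      by (simp add: blinfun.zero_right)
    have "(\<lambda>n. dual_apply w (Bochner_Integration.simple_bochner_integral M (s n))) \<longlonglongrightarrow> dual_apply w y"
      by (intro blinfun.tendsto tendsto_const s(3))
    then show "(\<lambda>n. Bochner_Integration.simple_bochner_integral M (\<lambda>x. dual_apply w (s n x))) \<longlonglongrightarrow> dual_apply w y"
      using s(1) by (simp add: simple_bochner_integral_linear bounded_linear.linear[OF blinfun.bounded_linear_right])
    have "(\<integral>\<^sup>+x. ennreal (norm (dual_apply w (g x) - dual_apply w (s n x))) \<partial>M)
        \<le> (\<integral>\<^sup>+x. ennreal (norm (g x - s n x)) \<partial>M)" for n
      using dual_ball_le_norm[of w]
      by (intro nn_integral_mono ennreal_leI) (simp flip: blinfun.diff_right)
    then show "(\<lambda>n. \<integral>\<^sup>+x. ennreal (norm (dual_apply w (g x) - dual_apply w (s n x))) \<partial>M) \<longlonglongrightarrow> 0"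
      using tendsto_sandwich[OF always_eventually always_eventually tendsto_const s(2)] by simp
  qed
qed

section \<open>Restriction of strong measurability and Bochner integrability\<close>

lemma simple_function_restrict:
  assumes "simple_function M f"
  shows "simple_function (restrict_space M S) f"
proof -
  have "f ` space (restrict_space M S) \<subseteq> f ` space M"
    by (auto simp: space_restrict_space)
  from finite_subset[OF this] assms show ?thesis
    by (auto simp: simple_function_eq_measurable intro: measurable_restrict_space1)
qed

lemma strongly_measurable_restrict:
  assumes "strongly_measurable M f" "S \<in> sets M"
  shows "strongly_measurable (restrict_space M S) f"
proof -
  obtain s where s: "\<And>n. simple_function M (s n)" "AE x in M. (\<lambda>n. s n x) \<longlonglongrightarrow> f x"
    using assms(1) by (auto simp: strongly_measurable_def)
  have "AE x in restrict_space M S. (\<lambda>n. s n x) \<longlonglongrightarrow> f x"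
    using s(2) assms(2) by (subst AE_restrict_space_iff) auto
  with s(1) show ?thesis
    by (auto simp: strongly_measurable_def intro: simple_function_restrict)
qed

text \<open>The same simple functions approximate on \<open>S\<close>. Their integrals over
  \<open>S\<close> form a Cauchy sequence because they are Cauchy in mean, and completeness of the
  space supplies the limit.\<close>

lemma Bochner_integrable_restrict:
  fixes f :: "'a \<Rightarrow> 'b::banach"
  assumes f: "Bochner_integrable M f" and S: "S \<in> sets M"
  shows "Bochner_integrable (restrict_space M S) f"
proof -
  let ?N = "restrict_space M S"
  obtain s where s: "\<And>n. Bochner_Integration.simple_bochner_integrable M (s n)"
      "(\<lambda>n. \<integral>\<^sup>+x. ennreal (norm (f x - s n x)) \<partial>M) \<longlonglongrightarrow> 0"
    and sm: "strongly_measurable M f"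
    using f by (auto simp: Bochner_integrable_def has_Bochner_integral_def)
  let ?S = "\<lambda>n. \<integral>\<^sup>+x. ennreal (norm (f x - s n x)) \<partial>M"
  let ?I = "\<lambda>n. Bochner_Integration.simple_bochner_integral ?N (s n)"
  have sf: "simple_function M (s n)" for n
    using s(1)[of n] by (auto elim: simple_bochner_integrable.cases)
  have restrict: "Bochner_Integration.simple_bochner_integrable ?N r"
    if "Bochner_Integration.simple_bochner_integrable M r" for r :: "'a \<Rightarrow> 'c::real_normed_vector"
    using that
  proof cases
    case 1
    have meas: "{y \<in> space M. r y \<noteq> 0} \<in> sets M"
      using simple_functionD(2)[OF 1(1), of "- {0}"] by (simp add: vimage_def Int_def conj_commute)
    have "emeasure ?N {y \<in> space ?N. r y \<noteq> 0} \<le> emeasure M {y \<in> space M. r y \<noteq> 0}"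
      using S meas sets.sets_into_space[OF S]
      by (subst emeasure_restrict_space) (auto simp: space_restrict_space intro!: emeasure_mono)
    with 1 show ?thesis
      by (auto intro!: simple_bochner_integrable.intros simple_function_restrict simp: top_unique)
  qed
  have mono: "(\<integral>\<^sup>+x. u x \<partial>?N) \<le> (\<integral>\<^sup>+x. u x \<partial>M)" for u
    using S by (subst nn_integral_restrict_space) (auto intro!: nn_integral_mono simp: indicator_def)
  have bound: "ennreal (norm (?I n - ?I m)) \<le> ?S n + ?S m" for n m
  proof -
    \<comment> \<open>Additivity of the nonnegative integral is applied to Borel representatives of
      the two distances.\<close>
    obtain h where h: "h \<in> borel_measurable M" "AE x in M. norm (f x - s n x) = h x"
      using strongly_measurable_norm_diff_AE[OF sm sf] by blast
    obtain k where k: "k \<in> borel_measurable M" "AE x in M. norm (f x - s m x) = k x"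
      using strongly_measurable_norm_diff_AE[OF sm sf] by blast
    have st: "Bochner_Integration.simple_bochner_integrable ?N (\<lambda>x. s n x - s m x)"
      by (rule restrict, rule simple_bochner_integrable_compose2[OF _ s(1) s(1)]) simp
    have norm_st: "Bochner_Integration.simple_bochner_integrable ?N (\<lambda>x. norm (s n x - s m x))"
      using simple_bochner_integrable_compose2[OF _ st st, of "\<lambda>u _. norm u"] by simp
    have "norm (?I n - ?I m) \<le> Bochner_Integration.simple_bochner_integral ?N (\<lambda>x. norm (s n x - s m x))"
      using simple_bochner_integral_norm_bound[OF st] s(1)
      by (simp add: simple_bochner_integral_diff restrict)
    then have "ennreal (norm (?I n - ?I m)) \<le> (\<integral>\<^sup>+x. ennreal (norm (s n x - s m x)) \<partial>?N)"
      by (subst simple_bochner_integral_eq_nn_integral[OF norm_st, symmetric]) (auto intro: ennreal_leI)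
    also have "\<dots> \<le> (\<integral>\<^sup>+x. ennreal (norm (s n x - s m x)) \<partial>M)" by (rule mono)
    also have "\<dots> \<le> (\<integral>\<^sup>+x. ennreal (h x) + ennreal (k x) \<partial>M)"
    proof (rule nn_integral_mono_AE)
      show "AE x in M. ennreal (norm (s n x - s m x)) \<le> ennreal (h x) + ennreal (k x)"
        using h(2) k(2)
      proof eventually_elim
        case (elim x)
        have "norm (s n x - s m x) \<le> norm (f x - s n x) + norm (f x - s m x)"
          by (metis dual_order.refl norm_diff_triangle_le norm_minus_commute)
        then show ?case unfolding elim(1)[symmetric] elim(2)[symmetric]
          by (simp flip: ennreal_plus)
      qed
    qed
    also have "\<dots> = (\<integral>\<^sup>+x. ennreal (h x) \<partial>M) + (\<integral>\<^sup>+x. ennreal (k x) \<partial>M)"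
      using h(1) k(1) by (intro nn_integral_add) auto
    also have "(\<integral>\<^sup>+x. ennreal (h x) \<partial>M) = ?S n"
      using h(2) by (intro nn_integral_cong_AE) auto
    also have "(\<integral>\<^sup>+x. ennreal (k x) \<partial>M) = ?S m"
      using k(2) by (intro nn_integral_cong_AE) auto
    finally show ?thesis .
  qed
  have "Cauchy ?I"
  proof (rule metric_CauchyI)
    fix e :: real assume e: "0 < e"
    then obtain n0 where n0: "\<And>n. n0 \<le> n \<Longrightarrow> ?S n < ennreal (e / 2)"
      using order_tendstoD(2)[OF s(2), of "ennreal (e / 2)"] by (auto simp: eventually_sequentially)
    have "dist (?I m) (?I n) < e" if "n0 \<le> m" "n0 \<le> n" for m n
    proof -
      have "ennreal (norm (?I m - ?I n)) < ennreal (e / 2) + ennreal (e / 2)"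
        using bound[of m n] add_strict_mono[OF n0[OF that(1)] n0[OF that(2)]] by (rule le_less_trans)
      then show ?thesis
        using e by (simp add: dist_norm ennreal_less_iff flip: ennreal_plus)
    qed
    then show "\<exists>n0. \<forall>m\<ge>n0. \<forall>n\<ge>n0. dist (?I m) (?I n) < e" by blast
  qed
  then obtain y where "?I \<longlonglongrightarrow> y" by (auto simp: Cauchy_convergent_iff convergent_def)
  moreover have "(\<lambda>n. \<integral>\<^sup>+x. ennreal (norm (f x - s n x)) \<partial>?N) \<longlonglongrightarrow> 0"
    using tendsto_sandwich[OF always_eventually always_eventually tendsto_const s(2)] mono by simp
  ultimately show ?thesis
    using strongly_measurable_restrict[OF sm S] restrict[OF s(1)]
    by (auto simp: Bochner_integrable_def has_Bochner_integral_def)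
qed

section \<open>The integral inequality\<close>

lemma exists_almost_minimizer:
  fixes f :: "'a \<Rightarrow> real"
  assumes "E \<noteq> {}" "\<And>x. x \<in> E \<Longrightarrow> 0 \<le> f x" "0 < e"
  shows "\<exists>p\<in>E. \<forall>x\<in>E. f p \<le> f x + e"
proof -
  have bdd: "bdd_below (f ` E)" using assms(2) by (rule bdd_belowI2)
  obtain p where p: "p \<in> E" "f p < (INF x\<in>E. f x) + e"
    using cINF_less_iff[OF assms(1) bdd, of "(INF x\<in>E. f x) + e"] assms(3) by auto
  moreover have "(INF x\<in>E. f x) \<le> f x" if "x \<in> E" for x
    using that by (intro cINF_lower bdd)
  ultimately show ?thesis by (intro bexI[of _ p]) (force intro: order_trans)+
qed

text \<open>The factor \<open>c\<close> is 1 for the sections themselves and \<open>T\<close> for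
  the integrand of the inequality.\<close>

lemma (in convex_measure_of_nonproperty) borel_measurable_measure_of_section:
  fixes G :: "(real \<Rightarrow> 'a) set"
  assumes "complete_measure M" and G: "G \<noteq> {}" and c: "0 < c"
    and bound: "AE s in M. \<forall>g\<in>G. norm (g s) \<le> \<psi> s"
    and J: "strongly_measurable M (support_fun G)"
  shows "(\<lambda>s. \<mu> {c *\<^sub>R g s | g. g \<in> G}) \<in> borel_measurable M"
proof -
  interpret complete_measure M by fact
  show ?thesis
  proof (rule borel_measurable_along_strongly_measurable[OF J])
    show "AE s in M. s \<in> {s. bounded {g s | g. g \<in> G}}"
      using bound by eventually_elim (auto simp: bounded_iff)
  qed (rule continuous_along_support_fun[OF G c], auto)
qed

text \<open>Sampling each set \<open>E\<close> of the partition at an almost minimizer \<open>p E\<close> of the integrand keeps the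
  sum coming from Jensen's inequality below the integral.\<close>

lemma (in convex_measure_of_nonproperty) measure_integral_le:
  fixes G :: "(real \<Rightarrow> 'a) set" and I :: "(real \<Rightarrow> 'a) \<Rightarrow> 'a"
  assumes M: "complete_measure M" "finite_measure M" and \<D>: "fundamental_subsemigroup \<D>"
    and T: "T = measure M (space M)" "0 < T" and G: "G \<noteq> {}"
    and I: "\<And>g. g \<in> G \<Longrightarrow> has_Bochner_integral M g (I g)"
    and \<psi>: "integrable M \<psi>" and bound: "AE s in M. \<forall>g\<in>G. norm (g s) \<le> \<psi> s"
    and J: "strongly_measurable M (support_fun G)"
  shows "ennreal (\<mu> (I ` G)) \<le> ennreal (1 / T) * (\<integral>\<^sup>+s. ennreal (\<mu> {T *\<^sub>R g s | g. g \<in> G}) \<partial>M)"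
proof -
  interpret complete_measure M by fact
  interpret finite_measure M by fact
  define Q where "Q s = {T *\<^sub>R g s | g. g \<in> G}" for s
  define F where "F s = \<mu> (Q s)" for s
  define S where "S = {s. \<forall>g\<in>G. norm (g s) \<le> \<psi> s}"
  have S: "AE s in M. s \<in> S" using bound by (simp add: S_def)
  have S_bounded: "bounded {g s | g. g \<in> G}" if "s \<in> S" for s
    using that by (auto simp: S_def bounded_iff)
  have Q: "Q s \<in> bounded_sets" if "s \<in> S" for s
  proof -
    have "bounded ((\<lambda>x. T *\<^sub>R x) ` {g s | g. g \<in> G})"
      by (intro bounded_scaling S_bounded that)
    moreover have "Q s = (\<lambda>x. T *\<^sub>R x) ` {g s | g. g \<in> G}" by (auto simp: Q_def)
    ultimately show ?thesis using G by (auto simp: bounded_sets_def)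
  qed
  have F_nonneg: "0 \<le> F s" if "s \<in> S" for s
    unfolding F_def by (intro nonneg Q that)
  have \<psi>_nonneg: "0 \<le> \<psi> s" if "s \<in> S" for s
    using that G by (auto simp: S_def intro: order_trans[OF norm_ge_zero])
  have F_meas: "F \<in> borel_measurable M"
    using borel_measurable_measure_of_section[OF M(1) G T(2) bound J] by (simp add: F_def[abs_def] Q_def)
  have "ennreal (\<mu> (I ` G)) \<le> ennreal (1 / T) * (\<integral>\<^sup>+s. ennreal (F s) \<partial>M)"
  \<comment> \<open>An infinite integral makes the right side infinite, as \<open>1 / T > 0\<close>;
    otherwise \<open>F\<close> is integrable and real arithmetic is available.\<close>
  proof (cases "(\<integral>\<^sup>+s. ennreal (F s) \<partial>M) = \<infinity>")
    case True
    then show ?thesis using T(2) by (simp add: ennreal_mult_top)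
  next
    case False
    have AE_F: "AE s in M. 0 \<le> F s"
      using S by eventually_elim (rule F_nonneg)
    then have F_int: "integrable M F"
      using False F_meas by (intro integrableI_nonneg) (auto simp: less_top)
    define L where "L = (\<integral>s. F s \<partial>M)"
    define P where "P = (\<integral>s. \<psi> s \<partial>M)"
    \<comment> \<open>\<open>K\<close> and \<open>\<beta>\<close> are independent of
      \<open>\<epsilon>\<close>: \<open>P + T\<close> will bound the comparison set for every
      \<open>\<epsilon> \<le> 1\<close>, and \<open>\<beta>\<close> collects 1 from the remainder
      and 2 per unit of the total measure \<open>T\<close>.\<close>
    define K where "K = \<mu> (cball 0 (P + T + 1))"
    define \<beta> where "\<beta> = 1 + 2 * T"
    have approx: "\<mu> (I ` G) \<le> L / T + \<epsilon> + 2 * (\<beta> * \<epsilon>) * K"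
      if \<epsilon>: "0 < \<epsilon>" "\<epsilon> \<le> 1" "\<beta> * \<epsilon> \<le> 1 / 2" for \<epsilon>
    proof -
      obtain \<E> where \<E>: "finite \<E>" "disjoint \<E>" "\<E> \<subseteq> sets M" "{} \<notin> \<E>" "\<Union>\<E> \<subseteq> S"
        and osc': "\<forall>E\<in>\<E>. \<forall>x\<in>E. \<forall>y\<in>E. dist (support_fun G x) (support_fun G y) < \<epsilon>"
        and rest: "(\<integral>s. \<psi> s * indicator (space M - \<Union>\<E>) s \<partial>M) < \<epsilon>"
        by (rule strongly_measurable_partition[OF J S \<psi> \<epsilon>(1)])
      have osc: "dist (support_fun G x) (support_fun G y) < \<epsilon>" if "E \<in> \<E>" "x \<in> E" "y \<in> E" for E x y
        using osc' that by blast
      have ES: "x \<in> S" if "E \<in> \<E>" "x \<in> E" for E x using that \<E>(5) by blast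
      have "\<exists>p\<in>E. \<forall>x\<in>E. F p \<le> F x + \<epsilon>" if "E \<in> \<E>" for E
        using that \<E>(4) \<epsilon>(1) by (intro exists_almost_minimizer F_nonneg ES[of E]) auto
      then obtain p where p: "\<And>E. E \<in> \<E> \<Longrightarrow> p E \<in> E"
        and F_p: "\<And>E x. E \<in> \<E> \<Longrightarrow> x \<in> E \<Longrightarrow> F (p E) \<le> F x + \<epsilon>"
        by metis
      have pS: "p E \<in> S" if "E \<in> \<E>" for E using ES[OF that p[OF that]] .
      define u where "u E = measure M E / T" for E
      have u_nonneg: "0 \<le> u E" for E using T(2) by (simp add: u_def)
      have "(\<Sum>E\<in>\<E>. measure M E * 1) \<le> (\<integral>s. 1 \<partial>M)"
        by (rule step_function_integral_le[OF \<E>(1-3)]) auto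
      then have u_sum: "sum u \<E> \<le> 1"
        using T by (simp add: u_def flip: sum_divide_distrib)
      \<comment> \<open>The finite Minkowski sum of sampled sets weighted by relative measure; the
        missing weight is placed on \<open>{0}\<close>, where \<open>\<mu>\<close> vanishes.\<close>
      define B where "B = {(\<Sum>E\<in>\<E>. u E *\<^sub>R z E) + (1 - sum u \<E>) *\<^sub>R y | z y.
        (\<forall>E\<in>\<E>. z E \<in> Q (p E)) \<and> y \<in> {0}}"
      have "\<mu> B \<le> (\<Sum>E\<in>\<E>. u E * F (p E)) + (1 - sum u \<E>) * \<mu> {0}"
        unfolding B_def F_def
        by (intro jensen \<E>(1) Q pS u_nonneg u_sum) (auto simp: bounded_sets_def)
      also have "\<dots> = (\<Sum>E\<in>\<E>. measure M E * F (p E)) / T"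
        by (simp add: measure_zero[OF \<D>] u_def sum_divide_distrib)
      also have "(\<Sum>E\<in>\<E>. measure M E * F (p E)) \<le> (\<integral>s. F s + \<epsilon> \<partial>M)"
      proof (rule step_function_integral_le[OF \<E>(1-3)])
        show "AE s in M. (\<forall>E\<in>\<E>. s \<in> E \<longrightarrow> F (p E) \<le> F s + \<epsilon>) \<and> (s \<notin> \<Union>\<E> \<longrightarrow> 0 \<le> F s + \<epsilon>)"
          using AE_F
        proof eventually_elim
          case (elim s)
          with F_p \<epsilon>(1) show ?case by simp
        qed
      qed (use F_int in simp)
      also have "\<dots> = L + \<epsilon> * T"
        using F_int T(1) by (simp add: L_def)
      finally have \<mu>B: "\<mu> B \<le> L / T + \<epsilon>"
        using T(2) by (simp add: divide_right_mono add_divide_distrib)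
      have "B \<noteq> {}"
        using bounded_sets_weighted_sum[of \<E> "\<lambda>E. Q (p E)" "{0}" u "1 - sum u \<E>"] \<E>(1) Q pS
        by (auto simp: B_def bounded_sets_def)
      \<comment> \<open>On each \<open>E\<close>, closeness of support functions bounds the sampled
        value by \<open>\<psi> s + \<epsilon>\<close> for every \<open>s\<close> in
        \<open>E\<close>; integration gives \<open>P + \<epsilon> * T\<close>.\<close>
      moreover have "B \<subseteq> cball 0 (P + T)"
      proof
        fix b assume "b \<in> B"
        then obtain z where z: "b = (\<Sum>E\<in>\<E>. u E *\<^sub>R z E)" "\<forall>E\<in>\<E>. \<exists>g\<in>G. z E = T *\<^sub>R g (p E)"
          by (force simp: B_def Q_def)
        then obtain g where g: "\<And>E. E \<in> \<E> \<Longrightarrow> g E \<in> G" "\<And>E. E \<in> \<E> \<Longrightarrow> z E = T *\<^sub>R g E (p E)"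
          by metis
        have "norm b \<le> (\<Sum>E\<in>\<E>. norm (u E *\<^sub>R z E))" unfolding z(1) by (rule norm_sum)
        also have "\<dots> = (\<Sum>E\<in>\<E>. measure M E * norm (g E (p E)))"
          using T(2) by (intro sum.cong) (auto simp: g(2) u_def)
        also have "\<dots> \<le> (\<integral>s. \<psi> s + \<epsilon> \<partial>M)"
        proof (rule step_function_integral_le[OF \<E>(1-3)])
          have *: "norm (g E (p E)) \<le> \<psi> s + \<epsilon>" if "E \<in> \<E>" "s \<in> E" for E s
          proof -
            have "norm (g E (p E)) \<le> \<psi> s + dist (support_fun G (p E)) (support_fun G s)"
              using ES[OF that] by (intro support_fun_norm_le G S_bounded pS g that) (auto simp: S_def)
            then show ?thesis using osc[OF that(1) p[OF that(1)] that(2)] by simp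
          qed
          show "AE s in M. (\<forall>E\<in>\<E>. s \<in> E \<longrightarrow> norm (g E (p E)) \<le> \<psi> s + \<epsilon>) \<and> (s \<notin> \<Union>\<E> \<longrightarrow> 0 \<le> \<psi> s + \<epsilon>)"
            using S
          proof eventually_elim
            case (elim s)
            then have "0 \<le> \<psi> s + \<epsilon>" using \<psi>_nonneg[of s] \<epsilon>(1) by simp
            with * show ?case by blast
          qed
        qed (use \<psi> in simp)
        also have "\<dots> = P + \<epsilon> * T" using \<psi> T(1) by (simp add: P_def)
        also have "\<dots> \<le> P + T" using \<epsilon>(2) T(2) by simp
        finally show "b \<in> cball 0 (P + T)" by simp
      qed
      moreover have "\<exists>b\<in>B. dual_apply w y < dual_apply w b + \<beta> * \<epsilon>" if y: "y \<in> I ` G" for y w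
      proof -
        obtain g where g: "g \<in> G" "y = I g" using y by blast
        \<comment> \<open>Choosing an almost maximizer of \<open>w\<close> at each sampling point
          builds the element \<open>b\<close> that competes with \<open>y\<close>.\<close>
        have "\<exists>h\<in>G. \<forall>g\<in>G. \<forall>s\<in>S. dual_apply w (g s)
            < dual_apply w (h (p E)) + dist (support_fun G s) (support_fun G (p E)) + \<epsilon>" if "E \<in> \<E>" for E
          by (rule support_fun_approx[OF G S_bounded[OF pS[OF that]] \<epsilon>(1), of w])
            (use S_bounded in blast)
        then obtain h where h: "\<And>E. E \<in> \<E> \<Longrightarrow> h E \<in> G"
          and h_less: "\<And>E g s. E \<in> \<E> \<Longrightarrow> g \<in> G \<Longrightarrow> s \<in> S \<Longrightarrow> dual_apply w (g s)
            < dual_apply w (h E (p E)) + dist (support_fun G s) (support_fun G (p E)) + \<epsilon>"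
          by metis
        define b where "b = (\<Sum>E\<in>\<E>. u E *\<^sub>R T *\<^sub>R h E (p E))"
        have b: "b \<in> B"
          unfolding B_def b_def Q_def using h by (auto intro!: exI[of _ "\<lambda>E. T *\<^sub>R h E (p E)"])
        have wb: "dual_apply w b = (\<Sum>E\<in>\<E>. measure M E * dual_apply w (h E (p E)))"
          using T(2) by (simp add: b_def u_def blinfun.sum_right blinfun.scaleR_right)
        let ?R = "\<lambda>s. \<psi> s * indicator (space M - \<Union>\<E>) s"
        have wg: "has_bochner_integral M (\<lambda>s. dual_apply w (g s)) (dual_apply w y)"
          using has_bochner_integral_dual_apply[OF I[OF g(1)]] g(2) by simp
        have R_int: "integrable M ?R"
          using \<psi> \<E>(1,3) by (intro integrable_real_mult_indicator) auto
        \<comment> \<open>The signs are reversed because \<open>dual_apply w b\<close> must be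
          bounded from below. On \<open>E\<close>, oscillation and slack cost
          \<open>2 * \<epsilon>\<close>; off the partition, \<open>\<psi>\<close> in
          \<open>?R\<close> dominates \<open>dual_apply w (g s)\<close>.\<close>
        have "(\<Sum>E\<in>\<E>. measure M E * (- dual_apply w (h E (p E))))
          \<le> (\<integral>s. ?R s + 2 * \<epsilon> - dual_apply w (g s) \<partial>M)"
        proof (rule step_function_integral_le[OF \<E>(1-3)])
          show "AE s in M. (\<forall>E\<in>\<E>. s \<in> E \<longrightarrow> - dual_apply w (h E (p E)) \<le> ?R s + 2 * \<epsilon> - dual_apply w (g s))
            \<and> (s \<notin> \<Union>\<E> \<longrightarrow> 0 \<le> ?R s + 2 * \<epsilon> - dual_apply w (g s))"
            using S AE_space
          proof eventually_elim
            case (elim s)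
            have "- dual_apply w (h E (p E)) \<le> ?R s + 2 * \<epsilon> - dual_apply w (g s)"
              if E: "E \<in> \<E>" "s \<in> E" for E
            proof -
              have "?R s = 0" using E by (auto simp: indicator_def)
              then show ?thesis
                using h_less[OF E(1) g(1) elim(1)] osc[OF E(1,2) p[OF E(1)]] by linarith
            qed
            moreover have "0 \<le> ?R s + 2 * \<epsilon> - dual_apply w (g s)" if "s \<notin> \<Union>\<E>"
            proof -
              have "?R s = \<psi> s" using that elim by (auto simp: indicator_def)
              moreover have "dual_apply w (g s) \<le> \<psi> s"
                using elim(1) g(1) by (intro dual_ball_le_norm_trans) (auto simp: S_def)
              ultimately show ?thesis using \<epsilon>(1) by linarith
            qed
            ultimately show ?case by blast
          qed
        qed (use R_int wg in \<open>simp add: has_bochner_integral_iff\<close>)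
        also have "\<dots> = (\<integral>s. ?R s \<partial>M) + 2 * \<epsilon> * T - dual_apply w y"
          using R_int wg T(1) by (simp add: has_bochner_integral_iff)
        also have "\<dots> < \<beta> * \<epsilon> - dual_apply w y"
          using rest by (simp add: \<beta>_def algebra_simps)
        finally have "dual_apply w y < dual_apply w b + \<beta> * \<epsilon>"
          by (simp add: wb sum_negf)
        with b show ?thesis by blast
      qed
      moreover have "0 \<le> \<beta> * \<epsilon>" using \<epsilon>(1) T(2) by (simp add: \<beta>_def)
      ultimately have "\<mu> (I ` G) \<le> \<mu> B + 2 * (\<beta> * \<epsilon>) * \<mu> (cball 0 ((P + T) + 1))"
        using G \<epsilon>(3) by (intro measure_le_of_support_le) auto
      with \<mu>B show ?thesis by (simp add: K_def)
    qed
    have "\<mu> (I ` G) \<le> L / T"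
    proof (rule tendsto_lowerbound)
      have "((\<lambda>\<epsilon>. L / T + \<epsilon> + 2 * (\<beta> * \<epsilon>) * K) \<longlongrightarrow> L / T + 0 + 2 * (\<beta> * 0) * K) (at_right 0)"
        by (intro tendsto_intros)
      then show "((\<lambda>\<epsilon>. L / T + \<epsilon> + 2 * (\<beta> * \<epsilon>) * K) \<longlongrightarrow> L / T) (at_right 0)" by simp
      have \<beta>: "0 < \<beta>" using T(2) by (simp add: \<beta>_def)
      \<comment> \<open>The upper end encodes \<open>\<epsilon> \<le> 1\<close> and
        \<open>\<beta> * \<epsilon> \<le> 1 / 2\<close>, the conditions of
        \<open>approx\<close>.\<close>
      then have "eventually (\<lambda>\<epsilon>. \<epsilon> \<in> {0<..<min 1 (1 / (2 * \<beta>))}) (at_right 0)"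
        by (intro eventually_at_right_real) simp
      then show "eventually (\<lambda>\<epsilon>. \<mu> (I ` G) \<le> L / T + \<epsilon> + 2 * (\<beta> * \<epsilon>) * K) (at_right 0)"
        by eventually_elim (rule approx; use \<beta> in \<open>auto simp: field_simps\<close>)
    qed simp
    then have "ennreal (\<mu> (I ` G)) \<le> ennreal (1 / T * L)" by (intro ennreal_leI) simp
    also have "\<dots> = ennreal (1 / T) * (\<integral>\<^sup>+s. ennreal (F s) \<partial>M)"
      unfolding L_def nn_integral_eq_integral[OF F_int AE_F] using T(2) by (intro ennreal_mult') simp
    finally show ?thesis .
  qed
  then show ?thesis by (simp add: F_def Q_def)
qed

theorem theorem6p6:
  fixes \<D> :: "'a::banach set set" and \<mu> :: "'a set \<Rightarrow> real"
    and a :: real and G :: "(real \<Rightarrow> 'a) set" and \<psi> :: "real \<Rightarrow> real"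
  assumes infinite_dim: "\<not> (\<exists>B :: 'a set. finite B \<and> span B = UNIV)"
    and "fundamental_subsemigroup \<D>"
    and "convex_measure_of_nonproperty \<D> \<mu>"
    and "0 < a"
    and "G \<noteq> {}"
    and "\<forall>g\<in>G. Bochner_integrable (lebesgue_on {0..a}) g"
    and "\<exists>C::real. \<forall>g\<in>G. (\<integral>\<^sup>+t. ennreal (norm (g t)) \<partial>lebesgue_on {0..a}) \<le> ennreal C"
    and "integrable (lebesgue_on {0..a}) \<psi>"
    and "\<forall>t\<in>{0..a}. 0 \<le> \<psi> t"
    and "AE t in lebesgue_on {0..a}. \<forall>g\<in>G. norm (g t) \<le> \<psi> t"
    and "strongly_measurable (lebesgue_on {0..a}) (support_fun G)"
  shows "(\<lambda>t. \<mu> {g t | g. g \<in> G}) \<in> borel_measurable (lebesgue_on {0..a}) \<and>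
    (\<forall>t. 0 < t \<and> t \<le> a \<longrightarrow>
      ennreal (\<mu> {Bochner_integral (lebesgue_on {0..t}) g | g. g \<in> G})
        \<le> ennreal (1 / t) * (\<integral>\<^sup>+s. ennreal (\<mu> {t *\<^sub>R g s | g. g \<in> G}) \<partial>lebesgue_on {0..t}))"
proof (intro conjI allI impI)
  interpret convex_measure_of_nonproperty \<D> \<mu> by fact
  show "(\<lambda>t. \<mu> {g t | g. g \<in> G}) \<in> borel_measurable (lebesgue_on {0..a})"
    using borel_measurable_measure_of_section[OF complete_measure_lebesgue_on assms(5) zero_less_one assms(10,11)]
    by simp
  fix t assume t: "0 < t \<and> t \<le> a"
  have S: "{0..t} \<in> sets (lebesgue_on {0..a})"
    using t by (auto simp: sets_restrict_space image_iff intro!: bexI[of _ "{0..t}"])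
  \<comment> \<open>Restricting twice is restricting once, so the hypotheses on
    \<open>{0..a}\<close> pass to \<open>{0..t}\<close>.\<close>
  have eq: "restrict_space (lebesgue_on {0..a}) {0..t} = lebesgue_on {0..t}"
    using t by (simp add: restrict_restrict_space Int_absorb1)
  let ?I = "Bochner_integral (lebesgue_on {0..t})"
  have "ennreal (\<mu> (?I ` G))
      \<le> ennreal (1 / t) * (\<integral>\<^sup>+s. ennreal (\<mu> {t *\<^sub>R g s | g. g \<in> G}) \<partial>lebesgue_on {0..t})"
  proof (rule measure_integral_le)
    show "complete_measure (lebesgue_on {0..t})" by (rule complete_measure_lebesgue_on) simp
    show "finite_measure (lebesgue_on {0..t})" by (rule finite_measure_lebesgue_on) simp
    show "t = measure (lebesgue_on {0..t}) (space (lebesgue_on {0..t}))"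
      using t by (simp add: measure_restrict_space)
    \<comment> \<open>Integrability on the subinterval gives a value, and uniqueness identifies it
      with the definite description \<open>?I g\<close>.\<close>
    show "has_Bochner_integral (lebesgue_on {0..t}) g (?I g)" if "g \<in> G" for g
      using Bochner_integrable_restrict[OF _ S, of g] assms(6) that
      by (auto simp: eq Bochner_integrable_def Bochner_integral_eqI)
    show "integrable (lebesgue_on {0..t}) \<psi>"
      using integrable_mult_indicator[OF S assms(8)] S t
      by (subst eq[symmetric], subst integrable_restrict_space) (auto simp: min_absorb1)
    show "AE s in lebesgue_on {0..t}. \<forall>g\<in>G. norm (g s) \<le> \<psi> s"
      using assms(10) S t by (subst eq[symmetric], subst AE_restrict_space_iff) (auto simp: min_absorb1)
    show "strongly_measurable (lebesgue_on {0..t}) (support_fun G)"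
      using strongly_measurable_restrict[OF assms(11) S] by (simp add: eq)
  qed (use assms t in auto)
  then show "ennreal (\<mu> {?I g | g. g \<in> G})
      \<le> ennreal (1 / t) * (\<integral>\<^sup>+s. ennreal (\<mu> {t *\<^sub>R g s | g. g \<in> G}) \<partial>lebesgue_on {0..t})"
    by (simp add: Setcompr_eq_image)
qed

end
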